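(* Let $f_s^\varepsilon$ be the exponentially decaying force coefficient, and let $f_l^\varepsilon$ be the linear or the exponential force coefficient, described in the context. Consider the single straight vertical line $\bar x_k=(0,k/N)$, $k=1,\dots,N$, as a steady state of the particle model $\frac{\mathrm d x_j}{\mathrm d t}=\frac1N\sum_{k\ne j}\bar F(x_j-x_k)$ with force coefficients $f_s=f_s^\varepsilon$ and $f_l=f_l^\varepsilon$. (1) If $R_c=0.5$, then the straight vertical line is stable for any $N\in\mathbb N$ sufficiently large in the limit $\varepsilon\to0$. (2) If $R_c\in(0,0.5)$, then for any exponential decay $e_s>0$ the straight vertical line is unstable for any $N\in\mathbb N$ sufficiently large and for the continuum limit $N\to\infty$, in the limit $\varepsilon\to0$. (3) For any $0<\varepsilon\ll R_c$, the straight vertical line is an unstable steady state for any $R_c\in(0,0.5]$.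
   Context: Force: for given coefficients $f_l,f_s:[0,\infty)\to\mathbb R$ vanishing on $[R_c,\infty)$, with cutoff radius $R_c\in(0,\frac12]$, put $F(d)=(f_l(|d|)d_1,f_s(|d|)d_2)$ for $d\in[-\frac12,\frac12]^2$ and let $\bar F$ be its $\mathbb Z^2$-periodic extension to $\mathbb R^2$. Coefficient along $s=(0,1)$: for constants $c>0$, $e_s>0$, $$f_s^\varepsilon(r)=\begin{cases}c e^{-e_s r}-ce^{-e_s(R_c-\varepsilon)},&r\in[0,R_c-\varepsilon],\\ -ce_se^{-e_s(R_c-\varepsilon)}\Big(\frac{(r-R_c)^3}{\varepsilon^2}+\frac{(r-R_c)^2}{\varepsilon}\Big),&r\in(R_c-\varepsilon,R_c),\\0,&r\ge R_c.\end{cases}$$ Coefficient along $l=(1,0)$, one of the following two. (a) Linear: $$f_l^\varepsilon(r)=\begin{cases}a_lr+b_l,&r\in[0,R_c-\varepsilon],\\(2b_l+2R_ca_l-a_l\varepsilon)\frac{(r-R_c)^3}{\varepsilon^3}+(3b_l+3R_ca_l-2a_l\varepsilon)\frac{(r-R_c)^2}{\varepsilon^2},&r\in(R_c-\varepsilon,R_c),\\0,&r\ge R_c,\end{cases}$$ with $a_l<0$, $b_l>0$ and $a_l\le-\frac{2b_l}{R_c}$. (b) Exponential: $$f_l^\varepsilon(r)=\begin{cases}c_{l_1}e^{-e_{l_1}r}+c_{l_2}e^{-e_{l_2}r},&r\in[0,R_c-\varepsilon],\\\sum_{j=1}^2(-\varepsilon c_{l_j}e_{l_j}+2c_{l_j})e^{-e_{l_j}(R_c-\varepsilon)}\frac{(r-R_c)^3}{\varepsilon^3}+\sum_{j=1}^2(-\varepsilon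 c_{l_j}e_{l_j}+3c_{l_j})e^{-e_{l_j}(R_c-\varepsilon)}\frac{(r-R_c)^2}{\varepsilon^2},&r\in(R_c-\varepsilon,R_c),\\0,&r\ge R_c,\end{cases}$$ with $c_{l_1}>0>c_{l_2}$, $c_{l_1}>|c_{l_2}|$, $e_{l_1}>e_{l_2}>0$, chosen such that $\int_0^{R_c-\varepsilon}f_l^\varepsilon(s)(1-\cos(2\pi ms))\,\mathrm ds\le0$ for all $m\in\mathbb N$ and all $0<\varepsilon\ll R_c$. The notation $0<\varepsilon\ll R_c$ means $\varepsilon>0$ sufficiently small compared with $R_c$. Stability (linear): for fixed $m\in\mathbb N=\{1,2,\dots\}$, as $N\to\infty$ the two eigenvalues of the linearisation at the vertical line in the Fourier mode $m$ (perturbations proportional to $\cos(2\pi mj/N)$ in the particle index $j$) converge to $\lambda_1^\varepsilon(m),\lambda_2^\varepsilon(m)$ with $$\Re\lambda_1^\varepsilon(m)=2\int_0^{R_c}f_l^\varepsilon(s)(1-\cos(2\pi ms))\,\mathrm ds,\qquad \Re\lambda_2^\varepsilon(m)=2\int_0^{R_c}\big(f_s^\varepsilon(s)+s(f_s^\varepsilon)'(s)\big)(1-\cos(2\pi ms))\,\mathrm ds .$$ Following the criterion the paper uses: "stable for $N$ sufficiently large" means $\Re\lambda_i^\varepsilon(m)\le0$ for $i=1,2$ and all $m\in\mathbb N$. "Unstable (for $N$ sufficiently large and for $N\to\infty$)" means $\Re\lambda_i^\varepsilon(m)>0$ for some $i\in\{1,2\}$ and some $m\in\mathbb N$. "In the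 limit $\varepsilon\to0$" means that $\Re\lambda_i^\varepsilon(m)$ is replaced by $\lim_{\varepsilon\to0}\Re\lambda_i^\varepsilon(m)$ in these conditions. *)

theory Defs
  imports "HOL-Analysis.Analysis"
begin

section \<open>The particle model\<close>

definition force :: "(real \<Rightarrow> real) \<Rightarrow> (real \<Rightarrow> real) \<Rightarrow> real^2 \<Rightarrow> real^2" where
  "force fl fs d = vector [fl (norm d) * d $ 1, fs (norm d) * d $ 2]"

text \<open>The \<open>\<int>\<^sup>2\<close>-periodic extension of \<^const>\<open>force\<close> from the unit square centred at the origin:
  subtracting the nearest integer from each coordinate gives the representative in
  \<open>[-1/2, 1/2)\<^sup>2\<close>.  The choice of representative on the boundary of the square is immaterial for
  coefficients vanishing on \<open>[R\<^sub>c, \<infinity>)\<close> with \<open>R\<^sub>c \<le> 1/2\<close>, because boundary points have norm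
  at least \<open>1/2\<close>.\<close>

definition periodic_force :: "(real \<Rightarrow> real) \<Rightarrow> (real \<Rightarrow> real) \<Rightarrow> real^2 \<Rightarrow> real^2" where
  "periodic_force fl fs d = force fl fs (\<chi> i. d $ i - of_int (round (d $ i)))"

text \<open>Right-hand side of the particle model: the velocity of particle \<open>j\<close> in the configuration
  \<open>x 1, \<dots>, x N\<close>.\<close>

definition velocity ::
  "(real \<Rightarrow> real) \<Rightarrow> (real \<Rightarrow> real) \<Rightarrow> nat \<Rightarrow> (nat \<Rightarrow> real^2) \<Rightarrow> nat \<Rightarrow> real^2" where
  "velocity fl fs N x j = (1 / real N) *\<^sub>R (\<Sum>k\<in>{1..N} - {j}. periodic_force fl fs (x j - x k))"

definition steady_state ::
  "(real \<Rightarrow> real) \<Rightarrow> (real \<Rightarrow> real) \<Rightarrow> nat \<Rightarrow> (nat \<Rightarrow> real^2) \<Rightarrow> bool" where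
  "steady_state fl fs N x \<longleftrightarrow> (\<forall>j\<in>{1..N}. velocity fl fs N x j = 0)"

definition vertical_line :: "nat \<Rightarrow> nat \<Rightarrow> real^2" where
  "vertical_line N k = vector [0, real k / real N]"


section \<open>Linearisation at the vertical line and stability\<close>

definition fourier_mode :: "nat \<Rightarrow> nat \<Rightarrow> nat \<Rightarrow> real" where
  "fourier_mode N m j = cos (2 * pi * real m * real j / real N)"

text \<open>\<open>A\<close> is the matrix of the linearised particle model on the perturbations
  \<open>h j = fourier_mode N m j *\<^sub>R v\<close> with \<open>v \<in> \<real>\<^sup>2\<close>: the linearisation maps this perturbation to
  \<open>fourier_mode N m j *\<^sub>R (A *v v)\<close>.  Such an \<open>A\<close> is unique for \<open>N \<ge> 1\<close>, since
  \<open>fourier_mode N m N = 1\<close>.\<close>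

definition mode_linearisation ::
  "(real \<Rightarrow> real) \<Rightarrow> (real \<Rightarrow> real) \<Rightarrow> nat \<Rightarrow> nat \<Rightarrow> real^2^2 \<Rightarrow> bool" where
  "mode_linearisation fl fs N m A \<longleftrightarrow>
    (\<forall>v. \<forall>j\<in>{1..N}.
      ((\<lambda>t. velocity fl fs N (\<lambda>k. vertical_line N k + (t * fourier_mode N m k) *\<^sub>R v) j)
        has_vector_derivative fourier_mode N m j *\<^sub>R (A *v v)) (at 0))"

text \<open>\<open>\<mu>1\<close> and \<open>\<mu>2\<close> are the two complex eigenvalues of \<open>A\<close>, counted with algebraic
  multiplicity.\<close>

definition eigenvalue_pair :: "real^2^2 \<Rightarrow> complex \<Rightarrow> complex \<Rightarrow> bool" where
  "eigenvalue_pair A \<mu>1 \<mu>2 \<longleftrightarrow>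
    (\<forall>z. det (mat z - (\<chi> i j. complex_of_real (A $ i $ j))) = (z - \<mu>1) * (z - \<mu>2))"

text \<open>The eigenvalues in mode \<open>m\<close> converge to \<open>\<nu>1\<close> and \<open>\<nu>2\<close> as \<open>N \<rightarrow> \<infinity>\<close>.  The pair is
  determined up to order, on which none of the notions below depends.  For the coefficients
  considered here the real parts of the limits are
  \<open>2 \<integral> f\<^sub>l(s) (1 - cos (2\<pi>ms)) ds\<close> and \<open>2 \<integral> (f\<^sub>s(s) + s f\<^sub>s'(s)) (1 - cos (2\<pi>ms)) ds\<close>
  over \<open>[0, R\<^sub>c]\<close>.\<close>

definition limit_eigenvalues ::
  "(real \<Rightarrow> real) \<Rightarrow> (real \<Rightarrow> real) \<Rightarrow> nat \<Rightarrow> complex \<Rightarrow> complex \<Rightarrow> bool" where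
  "limit_eigenvalues fl fs m \<nu>1 \<nu>2 \<longleftrightarrow>
    (\<exists>\<mu>1 \<mu>2. \<mu>1 \<longlonglongrightarrow> \<nu>1 \<and> \<mu>2 \<longlonglongrightarrow> \<nu>2 \<and>
      (\<forall>\<^sub>F N in sequentially. \<exists>A. mode_linearisation fl fs N m A \<and> eigenvalue_pair A (\<mu>1 N) (\<mu>2 N)))"

definition unstable_line :: "(real \<Rightarrow> real) \<Rightarrow> (real \<Rightarrow> real) \<Rightarrow> bool" where
  "unstable_line fl fs \<longleftrightarrow>
    (\<exists>m\<ge>1. \<exists>\<nu>1 \<nu>2. limit_eigenvalues fl fs m \<nu>1 \<nu>2 \<and> (Re \<nu>1 > 0 \<or> Re \<nu>2 > 0))"

text \<open>For families of coefficients indexed by \<open>\<epsilon>\<close>: the real parts of the limit eigenvalues in mode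
  \<open>m\<close> exist for all small \<open>\<epsilon> > 0\<close> and converge to \<open>L1\<close> and \<open>L2\<close> as \<open>\<epsilon> \<rightarrow> 0\<close>.\<close>

definition eps_limit_real_parts ::
  "(real \<Rightarrow> real \<Rightarrow> real) \<Rightarrow> (real \<Rightarrow> real \<Rightarrow> real) \<Rightarrow> nat \<Rightarrow> real \<Rightarrow> real \<Rightarrow> bool" where
  "eps_limit_real_parts fl fs m L1 L2 \<longleftrightarrow>
    (\<exists>\<nu>1 \<nu>2. (\<forall>\<^sub>F \<epsilon> in at_right 0. limit_eigenvalues (fl \<epsilon>) (fs \<epsilon>) m (\<nu>1 \<epsilon>) (\<nu>2 \<epsilon>)) \<and>
      ((\<lambda>\<epsilon>. Re (\<nu>1 \<epsilon>)) \<longlongrightarrow> L1) (at_right 0) \<and> ((\<lambda>\<epsilon>. Re (\<nu>2 \<epsilon>)) \<longlongrightarrow> L2) (at_right 0))"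

definition stable_line_eps_limit ::
  "(real \<Rightarrow> real \<Rightarrow> real) \<Rightarrow> (real \<Rightarrow> real \<Rightarrow> real) \<Rightarrow> bool" where
  "stable_line_eps_limit fl fs \<longleftrightarrow>
    (\<forall>m\<ge>1. \<exists>L1 L2. eps_limit_real_parts fl fs m L1 L2 \<and> L1 \<le> 0 \<and> L2 \<le> 0)"

definition unstable_line_eps_limit ::
  "(real \<Rightarrow> real \<Rightarrow> real) \<Rightarrow> (real \<Rightarrow> real \<Rightarrow> real) \<Rightarrow> bool" where
  "unstable_line_eps_limit fl fs \<longleftrightarrow>
    (\<exists>m\<ge>1. \<exists>L1 L2. eps_limit_real_parts fl fs m L1 L2 \<and> (L1 > 0 \<or> L2 > 0))"


section \<open>The force coefficients\<close>

text \<open>Only the values at \<open>r \<ge> 0\<close> and \<open>0 < \<epsilon> < R\<close> are meaningful.\<close>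

definition exp_fs :: "real \<Rightarrow> real \<Rightarrow> real \<Rightarrow> real \<Rightarrow> real \<Rightarrow> real" where
  "exp_fs R c e \<epsilon> r =
    (if r \<le> R - \<epsilon> then c * exp (- e * r) - c * exp (- e * (R - \<epsilon>))
     else if r < R then
       - c * e * exp (- e * (R - \<epsilon>)) * ((r - R)^3 / \<epsilon>^2 + (r - R)^2 / \<epsilon>)
     else 0)"

definition linear_fl :: "real \<Rightarrow> real \<Rightarrow> real \<Rightarrow> real \<Rightarrow> real \<Rightarrow> real" where
  "linear_fl R a b \<epsilon> r =
    (if r \<le> R - \<epsilon> then a * r + b
     else if r < R then
       (2 * b + 2 * R * a - a * \<epsilon>) * ((r - R)^3 / \<epsilon>^3)
       + (3 * b + 3 * R * a - 2 * a * \<epsilon>) * ((r - R)^2 / \<epsilon>^2)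
     else 0)"

definition exp_fl ::
  "real \<Rightarrow> real \<Rightarrow> real \<Rightarrow> real \<Rightarrow> real \<Rightarrow> real \<Rightarrow> real \<Rightarrow> real" where
  "exp_fl R c1 e1 c2 e2 \<epsilon> r =
    (if r \<le> R - \<epsilon> then c1 * exp (- e1 * r) + c2 * exp (- e2 * r)
     else if r < R then
       ((- \<epsilon> * c1 * e1 + 2 * c1) * exp (- e1 * (R - \<epsilon>))
        + (- \<epsilon> * c2 * e2 + 2 * c2) * exp (- e2 * (R - \<epsilon>))) * ((r - R)^3 / \<epsilon>^3)
       + ((- \<epsilon> * c1 * e1 + 3 * c1) * exp (- e1 * (R - \<epsilon>))
        + (- \<epsilon> * c2 * e2 + 3 * c2) * exp (- e2 * (R - \<epsilon>))) * ((r - R)^2 / \<epsilon>^2)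
     else 0)"

definition is_linear_fl :: "real \<Rightarrow> (real \<Rightarrow> real \<Rightarrow> real) \<Rightarrow> bool" where
  "is_linear_fl R fl \<longleftrightarrow>
    (\<exists>a b. a < 0 \<and> b > 0 \<and> a \<le> - (2 * b / R) \<and> fl = linear_fl R a b)"

definition is_exp_fl :: "real \<Rightarrow> (real \<Rightarrow> real \<Rightarrow> real) \<Rightarrow> bool" where
  "is_exp_fl R fl \<longleftrightarrow>
    (\<exists>c1 e1 c2 e2. c1 > 0 \<and> 0 > c2 \<and> c1 > \<bar>c2\<bar> \<and> e1 > e2 \<and> e2 > 0 \<and> fl = exp_fl R c1 e1 c2 e2 \<and>
      (\<forall>\<^sub>F \<epsilon> in at_right 0. \<forall>m\<ge>(1::nat).
        integral {0..R - \<epsilon>} (\<lambda>s. fl \<epsilon> s * (1 - cos (2 * pi * real m * s))) \<le> 0))"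

end

theory Submission
  imports Defs
begin

text \<open>
  By translation and reflection symmetry the linearisation in mode \<open>m\<close> is diagonal, with entries that
  are Riemann sums for \<open>2 \<integral> f (1 - cos (2\<pi>ms))\<close>, where \<open>f\<close> is \<open>f\<^sub>l\<close> or \<open>f\<^sub>s + s f\<^sub>s'\<close>.  Integration by
  parts turns the second limit into \<open>- 4\<pi>m \<integral> s f\<^sub>s(s) sin (2\<pi>ms)\<close>, so everything depends on the sign of
  the sine coefficients of \<open>s f\<^sub>s(s)\<close> on \<open>[0, R]\<close>.  In the limit \<open>\<epsilon> \<rightarrow> 0\<close> this function vanishes at \<open>R\<close>
  with negative slope.  For \<open>R = 1/2\<close> its sine coefficients are explicit and nonnegative.  For
  \<open>R < 1/2\<close> the kink at \<open>R\<close> dominates for large \<open>m\<close>, with a factor \<open>sin (2\<pi>mR)\<close>, and the rotation by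
  \<open>R\<close> meets the arc where this factor is positive infinitely often.  For \<open>R = 1/2\<close> and small \<open>\<epsilon> > 0\<close>
  the kink is smoothed out, and the jumps of the second derivative take over as \<open>m \<rightarrow> \<infinity>\<close>.
\<close>


section \<open>Representatives modulo 1\<close>

text \<open>At half-integers the value is \<open>-1/2\<close>, because \<open>round\<close> rounds
  half up. There \<open>offset\<close> jumps and fails to be odd, while its modulus, the distance to
  the nearest integer, is even and continuous; hence the many moduli below.\<close>

definition offset :: "real \<Rightarrow> real" where
  "offset x = x - of_int (round x)"

lemma abs_offset_le_half: "\<bar>offset x\<bar> \<le> 1/2"
  using of_int_round_abs_le[of x] by (simp add: offset_def abs_minus_commute)

lemma offset_add_of_int: "offset (x + of_int n) = offset x"
proof -
  have "round (x + of_int n) = round x + n"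
    using floor_add_int[of "x + 1/2" n] by (simp add: round_def add_ac)
  then show ?thesis
    by (simp add: offset_def)
qed

lemma offset_eq_self:
  assumes "\<bar>x\<bar> < 1/2"
  shows "offset x = x"
  using round_unique'[of x 0] assms by (simp add: offset_def)

lemma offset_add_eq:
  assumes "\<bar>offset x + d\<bar> < 1/2"
  shows "offset (x + d) = offset x + d"
proof -
  have "offset (x + d) = offset ((offset x + d) + of_int (round x))"
    by (simp add: offset_def)
  then show ?thesis
    using assms by (simp add: offset_add_of_int offset_eq_self)
qed

lemma offset_minus:
  assumes "\<bar>offset x\<bar> \<noteq> 1/2"
  shows "offset (- x) = - offset x"
proof -
  have "offset (- x) = offset (- offset x + of_int (- round x))"
    by (simp add: offset_def)
  also have "\<dots> = offset (- offset x)"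
    by (rule offset_add_of_int)
  also have "\<dots> = - offset x"
    using assms abs_offset_le_half[of x] by (intro offset_eq_self) simp
  finally show ?thesis .
qed

lemma abs_offset_le: "\<bar>offset x\<bar> \<le> \<bar>x - of_int n\<bar>"
  unfolding offset_def by (rule round_diff_minimal)

lemma abs_offset_minus: "\<bar>offset (- x)\<bar> = \<bar>offset x\<bar>"
proof -
  have "\<bar>offset (- y)\<bar> \<le> \<bar>offset y\<bar>" for y
    using abs_offset_le[of "- y" "- round y"] by (simp add: offset_def abs_minus_commute)
  from this[of x] this[of "- x"] show ?thesis
    by simp
qed

text \<open>Measuring the distance from \<open>x\<close> to the integer nearest to \<open>y\<close>
  costs at most \<open>\<bar>x - y\<bar>\<close>, and the roles can be exchanged.\<close>

lemma abs_offset_lipschitz: "\<bar>\<bar>offset x\<bar> - \<bar>offset y\<bar>\<bar> \<le> \<bar>x - y\<bar>"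
proof -
  have "\<bar>offset x\<bar> \<le> \<bar>offset y\<bar> + \<bar>x - y\<bar>" for x y
    using abs_offset_le[of x "round y"] by (simp add: offset_def)
  from this[of x y] this[of y x] show ?thesis
    by linarith
qed

lemma continuous_on_abs_offset: "continuous_on A (\<lambda>x. \<bar>offset x\<bar>)"
proof (rule continuous_on_subset)
  show "continuous_on UNIV (\<lambda>x. \<bar>offset x\<bar>)"
    unfolding continuous_on_iff dist_real_def
    using abs_offset_lipschitz order.strict_trans1 by blast
qed simp

lemma isCont_abs_offset: "isCont (\<lambda>x. \<bar>offset x\<bar>) x"
  using continuous_on_abs_offset[of UNIV] by (simp add: continuous_on_eq_continuous_at)

lemma offset_eq_0_iff: "offset x = 0 \<longleftrightarrow> x \<in> \<int>"
proof
  assume "offset x = 0"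
  then have "x = of_int (round x)"
    by (simp add: offset_def)
  then show "x \<in> \<int>"
    using Ints_of_int by metis
qed (auto simp: offset_def elim!: Ints_cases)


section \<open>Linearisation at the vertical line\<close>

text \<open>A shift by one telescopes and leaves two end terms that are one period apart. Induction
  on \<open>a\<close> in both directions does the rest.\<close>

lemma sum_periodic_shift:
  fixes H :: "int \<Rightarrow> real"
  assumes per: "\<And>x. H (x + int N) = H x"
  shows "(\<Sum>k=1..N. H (a + int k)) = (\<Sum>k=1..N. H (int k))"
proof -
  have step: "(\<Sum>k=1..N. H (b + 1 + int k)) = (\<Sum>k=1..N. H (b + int k))" for b
  proof (cases "N = 0")
    case False
    have "(\<Sum>k=1..N. H (b + 1 + int k)) - (\<Sum>k=1..N. H (b + int k))
        = (\<Sum>k=1..N. H (b + int (Suc k)) - H (b + int k))"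
      by (simp add: sum_subtractf add_ac)
    also have "\<dots> = H (b + int (Suc N)) - H (b + int 1)"
      using False by (subst sum_Suc_diff) auto
    also have "\<dots> = 0"
      using per[of "b + 1"] by (simp add: add_ac)
    finally show ?thesis
      by simp
  qed simp
  show ?thesis
  proof (induction a rule: int_induct[where k = 0])
    case (step1 i)
    then show ?case using step[of i] by simp
  next
    case (step2 i)
    then show ?case using step[of "i - 1"] by simp
  qed simp
qed

text \<open>Reversing the order of summation replaces \<open>k\<close> by \<open>N + 1 - k\<close>,
  which turns the reflection into a shift by \<open>a - 1 - N\<close>.\<close>

lemma sum_periodic_reflect:
  fixes H :: "int \<Rightarrow> real"
  assumes per: "\<And>x. H (x + int N) = H x"
  shows "(\<Sum>k=1..N. H (a - int k)) = (\<Sum>k=1..N. H (int k))"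
proof -
  have "(\<Sum>k=1..N. H (a - int k)) = (\<Sum>k=1..N. H (a - int (Suc N - k)))"
    by (subst sum.atLeastAtMost_rev) simp
  also have "\<dots> = (\<Sum>k=1..N. H ((a - 1 - int N) + int k))"
    by (intro sum.cong refl arg_cong[of _ _ H]) auto
  also have "\<dots> = (\<Sum>k=1..N. H (int k))"
    by (rule sum_periodic_shift) (rule per)
  finally show ?thesis .
qed

lemma sum_odd_periodic:
  fixes H :: "int \<Rightarrow> real"
  assumes per: "\<And>x. H (x + int N) = H x" and odd: "\<And>x. H (- x) = - H x"
  shows "(\<Sum>k=1..N. H (a - int k)) = 0"
proof -
  have "(\<Sum>k=1..N. H (int k)) = (\<Sum>k=1..N. H (0 - int k))"
    by (rule sum_periodic_reflect[symmetric]) (rule per)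
  also have "\<dots> = - (\<Sum>k=1..N. H (int k))"
    by (simp add: odd sum_negf)
  finally show ?thesis
    using sum_periodic_reflect[of H N a] per by simp
qed

lemma offset_div_periodic:
  assumes "N \<ge> 1"
  shows "offset (of_int (x + int N) / real N) = offset (of_int x / real N)"
  using offset_add_of_int[of "of_int x / real N" 1] assms by (simp add: add_divide_distrib)

text \<open>Expressed through the moduli of the offsets, which stay continuous where
  \<open>offset\<close> itself jumps.\<close>

definition displacement_norm :: "real^2 \<Rightarrow> real" where
  "displacement_norm d = sqrt (\<bar>offset (d $ 1)\<bar>\<^sup>2 + \<bar>offset (d $ 2)\<bar>\<^sup>2)"

lemma periodic_force_nth:
  "periodic_force fl fs d $ 1 = fl (displacement_norm d) * offset (d $ 1)"
  "periodic_force fl fs d $ 2 = fs (displacement_norm d) * offset (d $ 2)"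
  by (simp_all add: periodic_force_def force_def displacement_norm_def norm_vec_def L2_set_def
      sum_2 offset_def)

lemma velocity_nth:
  "velocity fl fs N x j $ i = (\<Sum>k\<in>{1..N} - {j}. periodic_force fl fs (x j - x k) $ i) / real N"
  by (simp add: velocity_def)

lemma vertical_line_diff_nth:
  "(vertical_line N j - vertical_line N k) $ 1 = 0"
  "(vertical_line N j - vertical_line N k) $ 2 = of_int (int j - int k) / real N"
  by (simp_all add: vertical_line_def diff_divide_distrib)

text \<open>The vertical force is an odd, \<open>N\<close>-periodic function of the index
  difference, so it cancels over a full period. The zero of \<open>fs\<close> at \<open>1/2\<close>
  rescues oddness at half-integer displacements, where \<open>offset\<close> is not odd.\<close>

lemma steady_state_vertical_line:
  assumes "N \<ge> 1" and "fs (1/2) = 0"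
  shows "steady_state fl fs N (vertical_line N)"
  unfolding steady_state_def
proof
  fix j assume j: "j \<in> {1..N}"
  define H where "H x = fs \<bar>offset (of_int x / real N)\<bar> * offset (of_int x / real N)" for x :: int
  have per: "H (x + int N) = H x" for x
    using assms(1) unfolding H_def by (simp only: offset_div_periodic)
  have odd: "H (- x) = - H x" for x
  proof (cases "\<bar>offset (of_int x / real N)\<bar> = 1/2")
    case True
    then show ?thesis
      using assms(2) abs_offset_minus[of "of_int x / real N"] unfolding H_def of_int_minus divide_minus_left
      by (simp only: mult_zero_left minus_zero)
  next
    case False
    then show ?thesis
      using offset_minus[OF False] by (simp add: H_def)
  qed
  have "velocity fl fs N (vertical_line N) j $ 1 = 0"
    by (simp add: velocity_nth periodic_force_nth vertical_line_diff_nth offset_def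
        del: vector_minus_component)
  moreover have "velocity fl fs N (vertical_line N) j $ 2 = 0"
  proof -
    have "(\<Sum>k\<in>{1..N} - {j}. periodic_force fl fs (vertical_line N j - vertical_line N k) $ 2)
        = (\<Sum>k\<in>{1..N} - {j}. H (int j - int k))"
      unfolding periodic_force_nth vertical_line_diff_nth displacement_norm_def H_def
      by (simp add: offset_def)
    \<comment> \<open>The added index \<open>k = j\<close> contributes
      \<open>H 0 = 0\<close>.\<close>
    also have "\<dots> = (\<Sum>k=1..N. H (int j - int k))"
      using j by (subst sum.remove[of "{1..N}" j]) (auto simp: H_def offset_def)
    also have "\<dots> = 0"
      by (rule sum_odd_periodic[OF per odd])
    finally show ?thesis
      by (simp add: velocity_nth)
  qed
  ultimately show "velocity fl fs N (vertical_line N) j = 0"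
    by (simp add: vec_eq_iff forall_2)
qed

section \<open>Derivatives of the force between two particles\<close>

lemma abs_offset_0: "\<bar>offset 0\<bar> < 1/2"
  by (simp add: offset_eq_self)

lemma eventually_offset_add_eq:
  assumes "\<bar>offset y\<bar> < 1/2"
  shows "\<forall>\<^sub>F t in nhds 0. offset (y + t * q) = offset y + t * q"
proof -
  have "((\<lambda>t. \<bar>offset y + t * q\<bar>) \<longlongrightarrow> \<bar>offset y + 0 * q\<bar>) (nhds 0)"
    by (intro tendsto_intros filterlim_ident)
  then have "\<forall>\<^sub>F t in nhds 0. \<bar>offset y + t * q\<bar> < 1/2"
    by (rule order_tendstoD(2)) (use assms in simp)
  then show ?thesis
    by eventually_elim (rule offset_add_eq)
qed

lemma DERIV_transform_eventually:
  assumes "(f has_real_derivative D) (at x)" and "\<forall>\<^sub>F t in nhds x. f t = g t"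
  shows "(g has_real_derivative D) (at x)"
  using DERIV_cong_ev[OF refl assms(2) refl] assms(1) by blast

lemma DERIV_times_continuous:
  fixes G :: "real \<Rightarrow> real"
  assumes "isCont G 0"
  shows "((\<lambda>t. G t * (t * p)) has_real_derivative p * G 0) (at 0)"
proof -
  have "((\<lambda>t. p * G t) \<longlongrightarrow> p * G 0) (at 0)"
    using assms by (intro tendsto_intros) (simp add: isCont_def)
  then have "((\<lambda>h. (G (0 + h) * ((0 + h) * p) - G 0 * (0 * p)) / h) \<longlongrightarrow> p * G 0) (at 0)"
    by (rule Lim_transform_eventually) (auto simp: eventually_at_filter)
  then show ?thesis
    by (simp add: DERIV_def)
qed

text \<open>The horizontal offset vanishes at \<open>t = 0\<close>, so the coefficient is never
  differentiated; its continuity suffices, even where the vertical offset jumps.\<close>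

lemma normal_force_derivative:
  assumes cont: "\<And>r. isCont fl r"
  shows "((\<lambda>t. fl (sqrt (\<bar>offset (t * p)\<bar>\<^sup>2 + \<bar>offset (y + t * q)\<bar>\<^sup>2)) * offset (t * p))
    has_real_derivative p * fl \<bar>offset y\<bar>) (at 0)"
proof -
  define G where "G t = fl (sqrt (\<bar>offset (t * p)\<bar>\<^sup>2 + \<bar>offset (y + t * q)\<bar>\<^sup>2))" for t
  \<comment> \<open>Stated for abstract \<open>u\<close> and \<open>v\<close> so that the continuity
    rules stop at the moduli and do not descend to the discontinuous \<open>offset\<close>.\<close>
  have sqrt_sum: "isCont (\<lambda>t. sqrt ((u t)\<^sup>2 + (v t)\<^sup>2)) 0"
    if "isCont u 0" "isCont v 0" for u v :: "real \<Rightarrow> real"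
    using that by (intro continuous_intros)
  have "isCont (\<lambda>t. \<bar>offset (t * p)\<bar>) 0" "isCont (\<lambda>t. \<bar>offset (y + t * q)\<bar>) 0"
    by (rule isCont_o2[OF _ isCont_abs_offset], simp)+
  then have "isCont (\<lambda>t. sqrt (\<bar>offset (t * p)\<bar>\<^sup>2 + \<bar>offset (y + t * q)\<bar>\<^sup>2)) 0"
    using sqrt_sum by blast
  then have "isCont G 0"
    unfolding G_def by (rule isCont_o2) (rule cont)
  then have "((\<lambda>t. G t * (t * p)) has_real_derivative p * G 0) (at 0)"
    by (rule DERIV_times_continuous)
  moreover have "\<forall>\<^sub>F t in nhds 0. G t * (t * p) = G t * offset (t * p)"
    using eventually_offset_add_eq[of 0 p, OF abs_offset_0]
    by eventually_elim (simp add: offset_eq_self)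
  ultimately have "((\<lambda>t. G t * offset (t * p)) has_real_derivative p * G 0) (at 0)"
    by (rule DERIV_transform_eventually)
  moreover have "G 0 = fl \<bar>offset y\<bar>"
    by (simp add: G_def offset_eq_self)
  ultimately show ?thesis
    by (simp add: G_def)
qed

lemma abs_sqrt_sum_squares_diff_le:
  fixes u v w :: real
  shows "\<bar>sqrt (u\<^sup>2 + v\<^sup>2) - w\<bar> \<le> \<bar>u\<bar> + \<bar>\<bar>v\<bar> - w\<bar>"
proof -
  have "\<bar>v\<bar> \<le> sqrt (u\<^sup>2 + v\<^sup>2)"
    by (rule real_le_rsqrt) simp
  moreover have "sqrt (u\<^sup>2 + v\<^sup>2) \<le> \<bar>u\<bar> + \<bar>v\<bar>"
    using sqrt_sum_squares_le_sum_abs[of u v] by simp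
  ultimately show ?thesis
    by linarith
qed

text \<open>Away from half-integers this is the chain rule, and \<open>offset y \<noteq> 0\<close>
  keeps the square root differentiable. At half-integers the offset jumps, but the double zero of
  \<open>fs\<close> at \<open>1/2\<close> makes the product of smaller order than \<open>t\<close>,
  so the derivative is 0.\<close>

lemma tangential_force_derivative:
  assumes deriv: "\<And>r. (fs has_real_derivative fs' r) (at r)"
    and zero: "fs (1/2) = 0" "fs' (1/2) = 0"
    and y: "offset y \<noteq> 0"
  shows "((\<lambda>t. fs (sqrt (\<bar>offset (t * p)\<bar>\<^sup>2 + \<bar>offset (y + t * q)\<bar>\<^sup>2)) * offset (y + t * q))
    has_real_derivative q * (fs \<bar>offset y\<bar> + \<bar>offset y\<bar> * fs' \<bar>offset y\<bar>)) (at 0)"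
proof (cases "\<bar>offset y\<bar> < 1/2")
  case True
  define z where "z = offset y"
  have z: "z \<noteq> 0" using y by (simp add: z_def)
  have "((\<lambda>t. sqrt ((t * p)\<^sup>2 + (z + t * q)\<^sup>2)) has_real_derivative z * q / \<bar>z\<bar>) (at 0)"
    using z by (auto intro!: derivative_eq_intros simp: field_simps)
  then have "((\<lambda>t. fs (sqrt ((t * p)\<^sup>2 + (z + t * q)\<^sup>2))) has_real_derivative fs' \<bar>z\<bar> * (z * q / \<bar>z\<bar>)) (at 0)"
    using DERIV_chain2[OF deriv, of "\<lambda>t. sqrt ((t * p)\<^sup>2 + (z + t * q)\<^sup>2)" "z * q / \<bar>z\<bar>" 0 UNIV] by simp
  then have "((\<lambda>t. fs (sqrt ((t * p)\<^sup>2 + (z + t * q)\<^sup>2)) * (z + t * q))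
      has_real_derivative q * (fs \<bar>z\<bar> + \<bar>z\<bar> * fs' \<bar>z\<bar>)) (at 0)"
    using z by (auto intro!: derivative_eq_intros simp: field_simps abs_if)
  moreover have "\<forall>\<^sub>F t in nhds 0. fs (sqrt ((t * p)\<^sup>2 + (z + t * q)\<^sup>2)) * (z + t * q)
      = fs (sqrt (\<bar>offset (t * p)\<bar>\<^sup>2 + \<bar>offset (y + t * q)\<bar>\<^sup>2)) * offset (y + t * q)"
    using eventually_offset_add_eq[of 0 p, OF abs_offset_0] eventually_offset_add_eq[OF True, of q]
    by eventually_elim (simp add: offset_eq_self z_def)
  ultimately show ?thesis
    unfolding z_def by (rule DERIV_transform_eventually)
next
  case False
  then have half: "\<bar>offset y\<bar> = 1/2"
    using abs_offset_le_half[of y] by simp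
  define \<rho> where "\<rho> t = sqrt (\<bar>offset (t * p)\<bar>\<^sup>2 + \<bar>offset (y + t * q)\<bar>\<^sup>2)" for t
  define B where "B = \<bar>p\<bar> + \<bar>q\<bar> + 1"
  \<comment> \<open>Only moduli of offsets enter \<open>\<rho>\<close>, so the jump of
    \<open>offset\<close> does not spoil this linear bound.\<close>
  have \<rho>: "\<bar>\<rho> t - 1/2\<bar> \<le> B * \<bar>t\<bar>" for t
  proof -
    have "\<bar>offset (t * p)\<bar> \<le> \<bar>t\<bar> * \<bar>p\<bar>"
      using abs_offset_le[of "t * p" 0] by (simp add: abs_mult)
    moreover have "\<bar>\<bar>offset (y + t * q)\<bar> - 1/2\<bar> \<le> \<bar>t\<bar> * \<bar>q\<bar>"
      using abs_offset_lipschitz[of "y + t * q" y] half by (simp add: abs_mult)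
    moreover have "B * \<bar>t\<bar> = \<bar>t\<bar> * \<bar>p\<bar> + \<bar>t\<bar> * \<bar>q\<bar> + \<bar>t\<bar>"
      by (simp add: B_def algebra_simps)
    ultimately show ?thesis
      using abs_sqrt_sum_squares_diff_le[of "\<bar>offset (t * p)\<bar>" "\<bar>offset (y + t * q)\<bar>" "1/2"]
      unfolding \<rho>_def[symmetric] abs_idempotent by linarith
  qed
  \<comment> \<open>The double zero at \<open>1/2\<close> in epsilon-delta form: \<open>fs\<close>
    is smaller there than any linear function.\<close>
  have small: "\<exists>d>0. \<forall>s. \<bar>s - 1/2\<bar> < d \<longrightarrow> \<bar>fs s\<bar> \<le> k * \<bar>s - 1/2\<bar>" if "k > 0" for k
    using deriv[of "1/2"] that zero
    unfolding has_field_derivative_def has_derivative_at_alt by (simp add: abs_mult)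
  have "((\<lambda>h. fs (\<rho> h) * offset (y + h * q) / h) \<longlongrightarrow> 0) (at 0)"
  proof (rule LIM_I)
    fix k :: real assume "k > 0"
    have B: "B > 0" by (simp add: B_def add_nonneg_pos)
    obtain d where d: "d > 0" "\<And>s. \<bar>s - 1/2\<bar> < d \<Longrightarrow> \<bar>fs s\<bar> \<le> k / B * \<bar>s - 1/2\<bar>"
      using small[of "k / B"] \<open>k > 0\<close> B by auto
    show "\<exists>s>0. \<forall>x. x \<noteq> 0 \<and> norm (x - 0) < s \<longrightarrow> norm (fs (\<rho> x) * offset (y + x * q) / x - 0) < k"
    proof (intro exI[of _ "d / B"] conjI allI impI)
      fix t :: real assume t: "t \<noteq> 0 \<and> norm (t - 0) < d / B"
      then have "B * \<bar>t\<bar> < d"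
        using B by (simp add: field_simps)
      then have "\<bar>fs (\<rho> t)\<bar> \<le> k / B * \<bar>\<rho> t - 1/2\<bar>"
        using \<rho>[of t] by (intro d) simp
      also have "\<dots> \<le> k / B * (B * \<bar>t\<bar>)"
        using \<rho>[of t] B \<open>k > 0\<close> by (intro mult_left_mono) auto
      also have "\<dots> = k * \<bar>t\<bar>"
        using B by simp
      finally have "\<bar>fs (\<rho> t)\<bar> * \<bar>offset (y + t * q)\<bar> \<le> (k * \<bar>t\<bar>) * (1/2)"
        using abs_offset_le_half by (intro mult_mono) (auto simp: \<open>k > 0\<close> less_imp_le)
      also have "\<dots> < k * \<bar>t\<bar>"
        using t \<open>k > 0\<close> by simp
      finally show "norm (fs (\<rho> t) * offset (y + t * q) / t - 0) < k"
        using t by (simp add: abs_mult field_simps)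
    qed (use d B in simp)
  qed
  moreover have "fs (\<rho> 0) = 0"
    by (simp add: \<rho>_def offset_eq_self half zero)
  ultimately show ?thesis
    unfolding \<rho>_def[symmetric] DERIV_def by (simp add: zero half del: mult_cancel_left)
qed

lemma has_vector_derivative_vec2I:
  fixes f :: "real \<Rightarrow> real^2"
  assumes "((\<lambda>t. f t $ 1) has_real_derivative D $ 1) (at x)"
    and "((\<lambda>t. f t $ 2) has_real_derivative D $ 2) (at x)"
  shows "(f has_vector_derivative D) (at x)"
proof -
  have "f = (\<lambda>t. (f t $ 1) *\<^sub>R axis 1 1 + (f t $ 2) *\<^sub>R axis 2 1)"
    by (simp add: fun_eq_iff vec_eq_iff forall_2 axis_def)
  moreover have "((\<lambda>t. (f t $ 1) *\<^sub>R axis 1 1 + (f t $ 2) *\<^sub>R axis (2::2) (1::real)) has_vector_derivative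
      (D $ 1) *\<^sub>R axis 1 1 + (D $ 2) *\<^sub>R axis 2 1) (at x)"
    using assms by (auto intro!: derivative_eq_intros simp: has_real_derivative_iff_has_vector_derivative)
  moreover have "(D $ 1) *\<^sub>R axis 1 1 + (D $ 2) *\<^sub>R axis 2 1 = D"
    by (simp add: vec_eq_iff forall_2 axis_def)
  ultimately show ?thesis
    by metis
qed

section \<open>Diagonalisation by cosine modes\<close>

text \<open>An eigenvalue of the finite system and at the same time a right-endpoint Riemann sum
  over \<open>[0, 1]\<close>. The summand \<open>k = N\<close>, which stands for the particle
  itself, vanishes because its cosine is 1.\<close>

definition mode_rate :: "(real \<Rightarrow> real) \<Rightarrow> nat \<Rightarrow> nat \<Rightarrow> real" where
  "mode_rate g m N = (\<Sum>k=1..N. g \<bar>offset (real k / real N)\<bar> * (1 - cos (2 * pi * real m * (real k / real N)))) / real N"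

text \<open>With \<open>k = j - (j - k)\<close> the addition theorem splits the cosine at
  \<open>k\<close>. The sine part is odd in \<open>j - k\<close> and cancels over a period; the
  cosine part reproduces the mode at \<open>j\<close> up to a factor independent of
  \<open>j\<close>.\<close>

lemma sum_mode_differences:
  assumes "N \<ge> 1" and j: "j \<in> {1..N}"
  shows "(\<Sum>k\<in>{1..N} - {j}. (fourier_mode N m j - fourier_mode N m k)
      * g \<bar>offset (of_int (int j - int k) / real N)\<bar>) / real N
    = fourier_mode N m j * mode_rate g m N"
proof -
  define w where "w = 2 * pi * real m / real N"
  define G where "G x = g \<bar>offset (of_int x / real N)\<bar>" for x :: int
  have G_per: "G (x + int N) = G x" for x
    using assms(1) unfolding G_def by (simp only: offset_div_periodic)
  have G_even: "G (- x) = G x" for x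
    using abs_offset_minus[of "of_int x / real N"] by (simp add: G_def)
  have wN: "w * (of_int x + real N) = w * of_int x + 2 * real m * pi" for x
    using assms(1) by (simp add: w_def field_simps)
  have c_per: "cos (w * of_int (x + int N)) = cos (w * of_int x)"
    and s_per: "sin (w * of_int (x + int N)) = sin (w * of_int x)" for x
    using wN[of "of_int x"] by (simp_all add: cos_add sin_add)
  have "(fourier_mode N m j - fourier_mode N m k) * g \<bar>offset (of_int (int j - int k) / real N)\<bar>
      = fourier_mode N m j * (G (int j - int k) * (1 - cos (w * of_int (int j - int k))))
        - sin (w * real j) * (G (int j - int k) * sin (w * of_int (int j - int k)))" for k
  proof -
    have "fourier_mode N m k = cos (w * real j - w * of_int (int j - int k))"
      by (simp add: fourier_mode_def w_def algebra_simps diff_divide_distrib)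
    moreover have "fourier_mode N m j = cos (w * real j)"
      by (simp add: fourier_mode_def w_def algebra_simps)
    ultimately show ?thesis
      unfolding G_def[symmetric] cos_diff by (simp add: algebra_simps)
  qed
  then have "(\<Sum>k=1..N. (fourier_mode N m j - fourier_mode N m k) * g \<bar>offset (of_int (int j - int k) / real N)\<bar>)
      = fourier_mode N m j * (\<Sum>k=1..N. (\<lambda>x. G x * (1 - cos (w * of_int x))) (int j - int k))
        - sin (w * real j) * (\<Sum>k=1..N. (\<lambda>x. G x * sin (w * of_int x)) (int j - int k))"
    by (simp add: sum_subtractf sum_distrib_left)
  also have "(\<Sum>k=1..N. (\<lambda>x. G x * sin (w * of_int x)) (int j - int k)) = 0"
    by (rule sum_odd_periodic) (simp_all only: G_per G_even s_per, simp)
  also have "(\<Sum>k=1..N. (\<lambda>x. G x * (1 - cos (w * of_int x))) (int j - int k))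
      = (\<Sum>k=1..N. (\<lambda>x. G x * (1 - cos (w * of_int x))) (int k))"
    by (rule sum_periodic_reflect) (simp only: G_per c_per)
  finally have "(\<Sum>k=1..N. (fourier_mode N m j - fourier_mode N m k) * g \<bar>offset (of_int (int j - int k) / real N)\<bar>)
      = fourier_mode N m j * (\<Sum>k=1..N. g \<bar>offset (real k / real N)\<bar> * (1 - cos (2 * pi * real m * (real k / real N))))"
    by (simp add: G_def w_def)
  moreover have "(\<Sum>k=1..N. (fourier_mode N m j - fourier_mode N m k) * g \<bar>offset (of_int (int j - int k) / real N)\<bar>)
      = (\<Sum>k\<in>{1..N} - {j}. (fourier_mode N m j - fourier_mode N m k) * g \<bar>offset (of_int (int j - int k) / real N)\<bar>)"
    using j by (subst sum.remove[of "{1..N}" j]) auto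
  ultimately show ?thesis
    by (simp add: mode_rate_def)
qed

text \<open>To first order the horizontal perturbation is felt only through \<open>fl\<close> and
  the vertical one only through \<open>fs\<close>, hence the zero off-diagonal entries.\<close>

lemma mode_linearisation_diagonal:
  assumes cont: "\<And>r. isCont fl r"
    and deriv: "\<And>r. (fs has_real_derivative fs' r) (at r)"
    and zero: "fs (1/2) = 0" "fs' (1/2) = 0"
    and "N \<ge> 1"
  shows "mode_linearisation fl fs N m
    (vector [vector [mode_rate fl m N, 0], vector [0, mode_rate (\<lambda>r. fs r + r * fs' r) m N]])"
  unfolding mode_linearisation_def
proof (intro allI ballI has_vector_derivative_vec2I)
  fix v :: "real^2" and j assume j: "j \<in> {1..N}"
  let ?A = "vector [vector [mode_rate fl m N, 0], vector [0, mode_rate (\<lambda>r. fs r + r * fs' r) m N]] :: real^2^2"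
  let ?x = "\<lambda>t k. vertical_line N k + (t * fourier_mode N m k) *\<^sub>R v"
  define p where "p i k = (fourier_mode N m j - fourier_mode N m k) * v $ i" for i k
  define y where "y k = of_int (int j - int k) / real N" for k
  have d1: "(?x t j - ?x t k) $ 1 = t * p 1 k" for t k
    by (simp add: vertical_line_def p_def algebra_simps)
  have d2: "(?x t j - ?x t k) $ 2 = y k + t * p 2 k" for t k
    by (simp add: vertical_line_def p_def y_def algebra_simps diff_divide_distrib)
  \<comment> \<open>Distinct particles are not congruent modulo 1, since their indices differ by
    less than \<open>N\<close>; the tangential derivative needs this.\<close>
  have y: "offset (y k) \<noteq> 0" if "k \<in> {1..N} - {j}" for k
  proof
    assume "offset (y k) = 0"
    then obtain n where n: "of_int (int j - int k) / real N = of_int n"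
      unfolding offset_eq_0_iff y_def by (auto elim: Ints_cases)
    then have "of_int (int j - int k) = (of_int (n * int N) :: real)"
      using \<open>N \<ge> 1\<close> by (simp add: field_simps)
    then have eq: "int j - int k = n * int N"
      by linarith
    have "\<bar>int j - int k\<bar> < int N"
      using j that by auto
    then have "\<bar>n\<bar> * int N < 1 * int N"
      unfolding eq by (simp add: abs_mult)
    then have "n = 0"
      by (simp only: mult_less_cancel_right) auto
    then show False
      using eq that by simp
  qed
  have "((\<lambda>t. velocity fl fs N (?x t) j $ 1) has_real_derivative
      (\<Sum>k\<in>{1..N} - {j}. p 1 k * fl \<bar>offset (y k)\<bar>) / real N) (at 0)"
    unfolding velocity_nth periodic_force_nth displacement_norm_def d1 d2
    by (intro DERIV_cdivide DERIV_sum normal_force_derivative cont)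
  also have "(\<Sum>k\<in>{1..N} - {j}. p 1 k * fl \<bar>offset (y k)\<bar>) / real N
      = v $ 1 * ((\<Sum>k\<in>{1..N} - {j}. (fourier_mode N m j - fourier_mode N m k) * fl \<bar>offset (y k)\<bar>) / real N)"
    by (simp add: p_def sum_distrib_left mult_ac)
  also have "\<dots> = (fourier_mode N m j *\<^sub>R (?A *v v)) $ 1"
    by (simp only: y_def sum_mode_differences[OF \<open>N \<ge> 1\<close> j])
      (simp add: matrix_vector_mult_def sum_2)
  finally show "((\<lambda>t. velocity fl fs N (?x t) j $ 1) has_real_derivative
    (fourier_mode N m j *\<^sub>R (?A *v v)) $ 1) (at 0)" .
  have "((\<lambda>t. velocity fl fs N (?x t) j $ 2) has_real_derivative
      (\<Sum>k\<in>{1..N} - {j}. p 2 k * (fs \<bar>offset (y k)\<bar> + \<bar>offset (y k)\<bar> * fs' \<bar>offset (y k)\<bar>)) / real N) (at 0)"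
    unfolding velocity_nth periodic_force_nth displacement_norm_def d1 d2
    by (intro DERIV_cdivide DERIV_sum tangential_force_derivative deriv zero y)
  also have "(\<Sum>k\<in>{1..N} - {j}. p 2 k * (fs \<bar>offset (y k)\<bar> + \<bar>offset (y k)\<bar> * fs' \<bar>offset (y k)\<bar>)) / real N
      = v $ 2 * ((\<Sum>k\<in>{1..N} - {j}. (fourier_mode N m j - fourier_mode N m k)
          * (\<lambda>r. fs r + r * fs' r) \<bar>offset (y k)\<bar>) / real N)"
    by (simp add: p_def sum_distrib_left mult_ac)
  also have "\<dots> = (fourier_mode N m j *\<^sub>R (?A *v v)) $ 2"
    by (simp only: y_def sum_mode_differences[OF \<open>N \<ge> 1\<close> j, of m "\<lambda>r. fs r + r * fs' r"])
      (simp add: matrix_vector_mult_def sum_2)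
  finally show "((\<lambda>t. velocity fl fs N (?x t) j $ 2) has_real_derivative
    (fourier_mode N m j *\<^sub>R (?A *v v)) $ 2) (at 0)" .
qed

lemma eigenvalue_pair_diagonal:
  "eigenvalue_pair (vector [vector [a, 0], vector [0, b]]) (of_real a) (of_real b)"
  by (simp add: eigenvalue_pair_def det_2 mat_def)


section \<open>The limit of many particles\<close>

text \<open>By uniform continuity the error on each cell is at most \<open>\<epsilon> / 2\<close>
  times the cell length as soon as the cells are shorter than \<open>d\<close>.\<close>

lemma riemann_sum_tendsto:
  fixes g :: "real \<Rightarrow> real"
  assumes cont: "continuous_on {0..1} g"
  shows "(\<lambda>N. (\<Sum>k=1..N. g (real k / real N)) / real N) \<longlonglongrightarrow> integral {0..1} g"
proof (rule LIMSEQ_I)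
  fix \<epsilon> :: real assume "\<epsilon> > 0"
  have "uniformly_continuous_on {0..1} g"
    using cont by (intro compact_uniformly_continuous) auto
  then obtain d where "d > 0"
    and d: "\<And>x y. x \<in> {0..1} \<Longrightarrow> y \<in> {0..1} \<Longrightarrow> \<bar>x - y\<bar> < d \<Longrightarrow> \<bar>g x - g y\<bar> < \<epsilon> / 2"
    unfolding uniformly_continuous_on_def dist_real_def using \<open>\<epsilon> > 0\<close> by (metis half_gt_zero)
  have cont': "continuous_on {a..b} g" if "0 \<le> a" "b \<le> 1" for a b
    using cont by (rule continuous_on_subset) (use that in auto)
  have bound: "\<bar>(\<Sum>k=1..N. g (real k / real N)) / real N - integral {0..1} g\<bar> \<le> \<epsilon> / 2"
    if N: "real N > 1 / d" for N
  proof -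
    have "N > 0"
      using N \<open>d > 0\<close> by (cases N) auto
    have "1 / real N < d"
      using N \<open>d > 0\<close> \<open>N > 0\<close> by (simp add: field_simps)
    define I where "I k = integral {real (k - 1) / real N..real k / real N} g" for k
    have "integral {0..real n / real N} g = (\<Sum>k=1..n. I k)" if "n \<le> N" for n
      using that
    proof (induction n)
      case (Suc n)
      have "integral {0..real (Suc n) / real N} g
          = integral {0..real n / real N} g + integral {real n / real N..real (Suc n) / real N} g"
        using Suc.prems \<open>N > 0\<close>
        by (intro Henstock_Kurzweil_Integration.integral_combine[symmetric] integrable_continuous_interval cont')
          (auto simp: field_simps)
      then show ?case
        using Suc by (simp add: I_def)
    qed simp
    from this[of N] have "integral {0..1} g = (\<Sum>k=1..N. I k)"
      using \<open>N > 0\<close> by simp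
    then have "(\<Sum>k=1..N. g (real k / real N)) / real N - integral {0..1} g
        = (\<Sum>k=1..N. g (real k / real N) / real N - I k)"
      by (simp add: sum_subtractf sum_divide_distrib)
    also have "\<bar>\<dots>\<bar> \<le> (\<Sum>k=1..N. (\<epsilon> / 2) / real N)"
    proof (rule order.trans[OF sum_abs sum_mono])
      fix k assume k: "k \<in> {1..N}"
      let ?a = "real (k - 1) / real N" and ?b = "real k / real N"
      have ab: "?a \<le> ?b" "0 \<le> ?a" "?b \<le> 1" "?b - ?a = 1 / real N"
        using k \<open>N > 0\<close> by (auto simp: field_simps)
      have "integral {?a..?b} (\<lambda>x. g ?b - g x) = g ?b / real N - I k"
        unfolding I_def using ab
        by (subst Henstock_Kurzweil_Integration.integral_diff)
          (auto intro!: integrable_continuous_interval cont' continuous_intros)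
      moreover have "norm (integral {?a..?b} (\<lambda>x. g ?b - g x)) \<le> \<epsilon> / 2 * (?b - ?a)"
      proof (rule integral_bound)
        fix x assume x: "x \<in> {?a..?b}"
        show "norm (g ?b - g x) \<le> \<epsilon> / 2"
          using d[of ?b x] x ab \<open>1 / real N < d\<close> order.trans[of 0 ?a x] by (auto intro: less_imp_le)
      qed (use ab in \<open>auto intro!: cont' continuous_intros\<close>)
      ultimately show "\<bar>g ?b / real N - I k\<bar> \<le> (\<epsilon> / 2) / real N"
        using ab by simp
    qed
    also have "\<dots> = \<epsilon> / 2"
      using \<open>N > 0\<close> by simp
    finally show ?thesis .
  qed
  obtain M :: nat where M: "real M > 1 / d"
    using reals_Archimedean2 by blast
  show "\<exists>M. \<forall>N\<ge>M. norm ((\<Sum>k=1..N. g (real k / real N)) / real N - integral {0..1} g) < \<epsilon>"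
  proof (intro exI[of _ M] allI impI)
    fix N assume "M \<le> N"
    then have "real N > 1 / d"
      using M by linarith
    from bound[OF this] show "norm ((\<Sum>k=1..N. g (real k / real N)) / real N - integral {0..1} g) < \<epsilon>"
      using \<open>\<epsilon> > 0\<close> by simp
  qed
qed

lemma abs_offset_eq_abs:
  assumes "\<bar>x\<bar> \<le> 1/2"
  shows "\<bar>offset x\<bar> = \<bar>x\<bar>"
proof (cases "\<bar>x\<bar> = 1/2")
  case True
  have "\<bar>offset (1/2)\<bar> = \<bar>1/2\<bar>"
    by (simp add: offset_def round_def)
  moreover have "x = 1/2 \<or> x = - (1/2)"
    using True by linarith
  ultimately show ?thesis
    using abs_offset_minus[of "1/2"] abs_minus_cancel[of "1/2 :: real"] by metis
qed (use assms in \<open>simp add: offset_eq_self\<close>)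

text \<open>The integrand on \<open>[0, 1]\<close> is symmetric about \<open>1/2\<close>, which
  gives the factor 2, and it vanishes between \<open>R\<close> and \<open>1/2\<close>.\<close>

lemma mode_rate_tendsto:
  assumes cont: "continuous_on UNIV g" and R: "0 \<le> R" "R \<le> 1/2"
    and vanish: "\<And>r. r \<ge> R \<Longrightarrow> g r = 0"
  shows "mode_rate g m \<longlonglongrightarrow> 2 * integral {0..R} (\<lambda>s. g s * (1 - cos (2 * pi * real m * s)))"
proof -
  define h where "h s = g s * (1 - cos (2 * pi * real m * s))" for s
  define G where "G x = g \<bar>offset x\<bar> * (1 - cos (2 * pi * real m * x))" for x
  have cont_h: "continuous_on A h" for A
    unfolding h_def by (intro continuous_intros continuous_on_subset[OF cont]) auto
  have cont_G: "continuous_on A G" for A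
    unfolding G_def
    by (intro continuous_intros continuous_on_compose2[OF cont] continuous_on_abs_offset) auto
  \<comment> \<open>The symmetry under \<open>1 - x\<close>, written as a shift followed by a
    reflection to match the two substitutions in the integral below.\<close>
  have "G (- (x + - 1)) = G x" for x
  proof -
    have "\<bar>offset (- (x + - 1))\<bar> = \<bar>offset x\<bar>"
      using abs_offset_minus[of "x + of_int (- 1)"] unfolding offset_add_of_int by simp
    moreover have "cos (2 * pi * real m * (- (x + - 1))) = cos (2 * pi * real m * x)"
    proof -
      have "2 * pi * real m * (- (x + - 1)) = 2 * real m * pi - 2 * pi * real m * x"
        by (simp add: algebra_simps)
      then show ?thesis
        by (simp only: cos_diff cos_2npi sin_2npi)
    qed
    ultimately show ?thesis
      unfolding G_def by simp
  qed
  then have "integral {1/2..1} G = integral {0..1/2} G"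
    using integral_reflect_real[of 1 "1/2" G, symmetric]
      integral_shift_real_ivl[of "- 1" "- 1" "- (1/2)" "\<lambda>x. G (- x)", symmetric] by simp
  moreover have "integral {0..1/2} G + integral {1/2..1} G = integral {0..1} G"
    by (intro Henstock_Kurzweil_Integration.integral_combine integrable_continuous_interval cont_G) auto
  moreover have "integral {0..1/2} G = integral {0..1/2} h"
    by (rule Henstock_Kurzweil_Integration.integral_cong) (simp add: G_def h_def abs_offset_eq_abs)
  moreover have "integral {0..R} h + integral {R..1/2} h = integral {0..1/2} h"
    using R by (intro Henstock_Kurzweil_Integration.integral_combine integrable_continuous_interval cont_h) auto
  moreover have "integral {R..1/2} h = integral {R..1/2} (\<lambda>_. 0)"
    by (rule Henstock_Kurzweil_Integration.integral_cong) (simp add: h_def vanish)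
  ultimately have "integral {0..1} G = 2 * integral {0..R} h"
    by simp
  then show ?thesis
    using riemann_sum_tendsto[OF cont_G] unfolding h_def G_def mode_rate_def by simp
qed

text \<open>\<open>f s + s * f' s\<close> is the derivative of \<open>s * f s\<close>. The boundary
  terms vanish, at 0 by the factor \<open>s\<close> and at \<open>R\<close> by
  \<open>f R = 0\<close>.\<close>

lemma integral_by_parts_mode:
  fixes f f' :: "real \<Rightarrow> real"
  assumes deriv: "\<And>r. (f has_real_derivative f' r) (at r)"
    and cont: "continuous_on UNIV f'" and "0 \<le> R" and "f R = 0"
  shows "integral {0..R} (\<lambda>s. (f s + s * f' s) * (1 - cos (w * s)))
    = - w * integral {0..R} (\<lambda>s. s * f s * sin (w * s))"
proof -
  have cont_f: "continuous_on A f" for A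
    using deriv DERIV_isCont continuous_at_imp_continuous_on by blast
  have cont_f': "continuous_on A f'" for A
    using cont by (rule continuous_on_subset) simp
  have "((\<lambda>s. (f s + s * f' s) * (1 - cos (w * s)) + w * (s * f s * sin (w * s)))
      has_integral R * f R * (1 - cos (w * R)) - 0 * f 0 * (1 - cos (w * 0))) {0..R}"
  proof (rule fundamental_theorem_of_calculus[OF \<open>0 \<le> R\<close>])
    fix x
    show "((\<lambda>s. s * f s * (1 - cos (w * s))) has_vector_derivative
        (f x + x * f' x) * (1 - cos (w * x)) + w * (x * f x * sin (w * x))) (at x within {0..R})"
      unfolding has_real_derivative_iff_has_vector_derivative[symmetric]
      by (rule DERIV_subset[of _ _ _ UNIV])
        (auto intro!: derivative_eq_intros deriv simp: algebra_simps)
  qed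
  then have "integral {0..R} (\<lambda>s. (f s + s * f' s) * (1 - cos (w * s)) + w * (s * f s * sin (w * s))) = 0"
    using \<open>f R = 0\<close> by (simp add: integral_unique)
  moreover have "integral {0..R} (\<lambda>s. (f s + s * f' s) * (1 - cos (w * s)) + w * (s * f s * sin (w * s)))
      = integral {0..R} (\<lambda>s. (f s + s * f' s) * (1 - cos (w * s))) + integral {0..R} (\<lambda>s. w * (s * f s * sin (w * s)))"
    by (intro Henstock_Kurzweil_Integration.integral_add integrable_continuous_interval continuous_intros cont_f cont_f')
  ultimately show ?thesis
    by simp
qed

text \<open>The second eigenvalue is stated after integration by parts, so that its sign is the
  opposite of that of a sine coefficient of \<open>s * fs s\<close>.\<close>

lemma limit_eigenvalues_real:
  assumes cont: "continuous_on UNIV fl"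
    and deriv: "\<And>r. (fs has_real_derivative fs' r) (at r)"
    and cont': "continuous_on UNIV fs'"
    and R: "0 \<le> R" "R \<le> 1/2"
    and vanish: "\<And>r. r \<ge> R \<Longrightarrow> fl r = 0" "\<And>r. r \<ge> R \<Longrightarrow> fs r = 0" "\<And>r. r \<ge> R \<Longrightarrow> fs' r = 0"
  shows "limit_eigenvalues fl fs m
    (of_real (2 * integral {0..R} (\<lambda>s. fl s * (1 - cos (2 * pi * real m * s)))))
    (of_real (- (4 * pi * real m) * integral {0..R} (\<lambda>s. s * fs s * sin (2 * pi * real m * s))))"
  unfolding limit_eigenvalues_def
proof (intro exI conjI)
  let ?g = "\<lambda>r. fs r + r * fs' r"
  have cont_fs: "continuous_on UNIV fs"
    using deriv DERIV_isCont continuous_at_imp_continuous_on by blast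
  show "(\<lambda>N. complex_of_real (mode_rate fl m N)) \<longlonglongrightarrow>
      of_real (2 * integral {0..R} (\<lambda>s. fl s * (1 - cos (2 * pi * real m * s))))"
    by (intro tendsto_of_real mode_rate_tendsto cont R vanish)
  have "mode_rate ?g m \<longlonglongrightarrow> 2 * integral {0..R} (\<lambda>s. ?g s * (1 - cos (2 * pi * real m * s)))"
    by (intro mode_rate_tendsto R continuous_intros cont_fs cont') (simp add: vanish)
  also have "integral {0..R} (\<lambda>s. ?g s * (1 - cos (2 * pi * real m * s)))
      = - (2 * pi * real m) * integral {0..R} (\<lambda>s. s * fs s * sin (2 * pi * real m * s))"
    by (rule integral_by_parts_mode[OF deriv cont' R(1)]) (simp add: vanish)
  finally have "mode_rate ?g m \<longlonglongrightarrow>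
      - (4 * pi * real m) * integral {0..R} (\<lambda>s. s * fs s * sin (2 * pi * real m * s))"
    by (simp add: mult.assoc)
  then show "(\<lambda>N. complex_of_real (mode_rate ?g m N)) \<longlonglongrightarrow>
      of_real (- (4 * pi * real m) * integral {0..R} (\<lambda>s. s * fs s * sin (2 * pi * real m * s)))"
    by (rule tendsto_of_real)
  show "\<forall>\<^sub>F N in sequentially. \<exists>A. mode_linearisation fl fs N m A \<and>
      eigenvalue_pair A (complex_of_real (mode_rate fl m N)) (complex_of_real (mode_rate ?g m N))"
    using eventually_ge_at_top[of 1]
  proof eventually_elim
    case (elim N)
    have "isCont fl r" for r
      using cont by (simp add: continuous_on_eq_continuous_at)
    then show ?case
      by (intro exI[of _ "vector [vector [mode_rate fl m N, 0], vector [0, mode_rate ?g m N]]"] conjI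
          eigenvalue_pair_diagonal mode_linearisation_diagonal deriv vanish R elim)
  qed
qed


section \<open>Cubic cutoffs\<close>

lemma has_real_derivative_If_le:
  fixes g h :: "real \<Rightarrow> real"
  assumes "\<And>x. (g has_real_derivative g' x) (at x)" "\<And>x. (h has_real_derivative h' x) (at x)"
    and "g p = h p" "g' p = h' p"
  shows "((\<lambda>x. if x \<le> p then g x else h x) has_real_derivative (if x \<le> p then g' x else h' x)) (at x)"
proof -
  have "((\<lambda>x. if x \<in> {..p} then g x else h x) has_vector_derivative (if x \<in> {..p} then g' x else h' x))
      (at x within UNIV)"
    by (rule has_vector_derivative_If_within_closures[where T = "{p<..}"])
      (use assms in \<open>auto simp: has_real_derivative_iff_has_vector_derivative[symmetric]
         intro: DERIV_subset\<close>)
  then show ?thesis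
    by (simp add: has_real_derivative_iff_has_vector_derivative)
qed

lemma continuous_on_If_le:
  fixes g h :: "real \<Rightarrow> real"
  assumes "continuous_on UNIV g" "continuous_on UNIV h" "g p = h p"
  shows "continuous_on UNIV (\<lambda>x. if x \<le> p then g x else h x)"
  by (rule continuous_on_cases_le)
    (use assms in \<open>auto intro: continuous_on_subset continuous_on_id\<close>)

text \<open>The cubic is the Hermite interpolant of the data \<open>g p, g' p\<close> at \<open>p = R - \<epsilon>\<close> and of a double
  zero at \<open>R\<close>; each of the force coefficients of the paper is a cutoff in this sense.\<close>

definition cutoff :: "real \<Rightarrow> real \<Rightarrow> (real \<Rightarrow> real) \<Rightarrow> (real \<Rightarrow> real) \<Rightarrow> real \<Rightarrow> real" where
  "cutoff R \<epsilon> g g' r =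
    (if r \<le> R - \<epsilon> then g r
     else if r \<le> R then
       (\<epsilon> * g' (R - \<epsilon>) + 2 * g (R - \<epsilon>)) * ((r - R) / \<epsilon>)^3
       + (\<epsilon> * g' (R - \<epsilon>) + 3 * g (R - \<epsilon>)) * ((r - R) / \<epsilon>)^2
     else 0)"

definition cutoff_deriv :: "real \<Rightarrow> real \<Rightarrow> (real \<Rightarrow> real) \<Rightarrow> (real \<Rightarrow> real) \<Rightarrow> real \<Rightarrow> real" where
  "cutoff_deriv R \<epsilon> g g' r =
    (if r \<le> R - \<epsilon> then g' r
     else if r \<le> R then
       3 * (\<epsilon> * g' (R - \<epsilon>) + 2 * g (R - \<epsilon>)) * ((r - R) / \<epsilon>)^2 / \<epsilon>
       + 2 * (\<epsilon> * g' (R - \<epsilon>) + 3 * g (R - \<epsilon>)) * ((r - R) / \<epsilon>) / \<epsilon>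
     else 0)"

lemma cutoff_eq_0: "\<epsilon> > 0 \<Longrightarrow> r \<ge> R \<Longrightarrow> cutoff R \<epsilon> g g' r = 0"
  by (auto simp: cutoff_def)

lemma cutoff_deriv_eq_0: "\<epsilon> > 0 \<Longrightarrow> r \<ge> R \<Longrightarrow> cutoff_deriv R \<epsilon> g g' r = 0"
  by (auto simp: cutoff_deriv_def)

lemma DERIV_cutoff:
  assumes "\<epsilon> > 0" and "\<And>r. (g has_real_derivative g' r) (at r)"
  shows "(cutoff R \<epsilon> g g' has_real_derivative cutoff_deriv R \<epsilon> g g' r) (at r)"
  unfolding cutoff_def[abs_def] cutoff_deriv_def
  by (intro has_real_derivative_If_le assms)
    (use assms(1) in \<open>auto intro!: derivative_eq_intros simp: field_simps power2_eq_square power3_eq_cube\<close>)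

lemma continuous_on_cutoff:
  assumes "\<epsilon> > 0" and "\<And>r. (g has_real_derivative g' r) (at r)"
  shows "continuous_on A (cutoff R \<epsilon> g g')"
  using DERIV_cutoff[OF assms] DERIV_isCont continuous_at_imp_continuous_on by blast

lemma continuous_on_cutoff_deriv:
  assumes "\<epsilon> > 0" and "continuous_on UNIV g'"
  shows "continuous_on UNIV (cutoff_deriv R \<epsilon> g g')"
  unfolding cutoff_deriv_def[abs_def]
  by (intro continuous_on_If_le assms continuous_intros) (use assms(1) in \<open>auto simp: field_simps\<close>)

text \<open>On the strip \<open>(r - R) / \<epsilon>\<close> lies in \<open>[-1, 0]\<close>, so the
  cubic is at most the sum of the moduli of its two coefficients. The bound does not blow up as
  \<open>\<epsilon>\<close> tends to 0.\<close>

lemma abs_cutoff_le: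
  assumes "\<epsilon> > 0" and "r \<in> {R - \<epsilon>..R}"
  shows "\<bar>cutoff R \<epsilon> g g' r\<bar> \<le> 2 * \<epsilon> * \<bar>g' (R - \<epsilon>)\<bar> + 5 * \<bar>g (R - \<epsilon>)\<bar>"
proof (cases "r = R - \<epsilon>")
  case True
  then show ?thesis
    using assms(1) by (simp add: cutoff_def)
next
  case False
  define q where "q = (r - R) / \<epsilon>"
  have q: "\<bar>q\<bar> \<le> 1"
    using assms by (auto simp: q_def abs_le_iff field_simps)
  have "\<bar>q ^ 3\<bar> \<le> 1" "\<bar>q ^ 2\<bar> \<le> 1"
    using power_le_one[OF _ q, of 3] power_le_one[OF _ q, of 2] by (simp_all add: power_abs)
  then have "\<bar>A * q ^ 3 + B * q ^ 2\<bar> \<le> \<bar>A\<bar> + \<bar>B\<bar>" for A B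
    by (intro order.trans[OF abs_triangle_ineq] add_mono)
      (simp_all add: abs_mult mult_left_le del: power_abs)
  moreover have "cutoff R \<epsilon> g g' r = (\<epsilon> * g' (R - \<epsilon>) + 2 * g (R - \<epsilon>)) * q ^ 3
      + (\<epsilon> * g' (R - \<epsilon>) + 3 * g (R - \<epsilon>)) * q ^ 2"
    using False assms by (simp add: cutoff_def q_def)
  moreover have "\<bar>\<epsilon> * g' (R - \<epsilon>) + n * g (R - \<epsilon>)\<bar> \<le> \<epsilon> * \<bar>g' (R - \<epsilon>)\<bar> + n * \<bar>g (R - \<epsilon>)\<bar>" if "n \<ge> 0" for n
    using assms(1) that by (intro order.trans[OF abs_triangle_ineq]) (simp add: abs_mult)
  from this[of 2] this[of 3] have "\<bar>\<epsilon> * g' (R - \<epsilon>) + 2 * g (R - \<epsilon>)\<bar> + \<bar>\<epsilon> * g' (R - \<epsilon>) + 3 * g (R - \<epsilon>)\<bar>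
      \<le> 2 * \<epsilon> * \<bar>g' (R - \<epsilon>)\<bar> + 5 * \<bar>g (R - \<epsilon>)\<bar>"
    by simp
  ultimately show ?thesis
    by (simp only:) (rule order.trans)
qed

lemma limit_eigenvalues_cutoff:
  assumes "\<And>r. (g has_real_derivative g' r) (at r)"
    and "\<And>r. (h has_real_derivative h' r) (at r)" and "continuous_on UNIV h'"
    and "0 \<le> R" "R \<le> 1/2" and "\<epsilon> > 0"
  shows "limit_eigenvalues (cutoff R \<epsilon> g g') (cutoff R \<epsilon> h h') m
    (of_real (2 * integral {0..R} (\<lambda>s. cutoff R \<epsilon> g g' s * (1 - cos (2 * pi * real m * s)))))
    (of_real (- (4 * pi * real m) * integral {0..R} (\<lambda>s. s * cutoff R \<epsilon> h h' s * sin (2 * pi * real m * s))))"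
  by (rule limit_eigenvalues_real[where fs' = "cutoff_deriv R \<epsilon> h h'"])
    (use assms in \<open>auto intro!: continuous_on_cutoff continuous_on_cutoff_deriv DERIV_cutoff
      simp: cutoff_eq_0 cutoff_deriv_eq_0\<close>)

section \<open>The force coefficients as cutoffs\<close>

text \<open>The shifted exponential vanishes at \<open>R - \<epsilon>\<close>, so both coefficients
  of the Hermite cubic reduce to \<open>\<epsilon>\<close> times the slope. Because of the shift the
  profile depends on \<open>\<epsilon>\<close>, but its derivative does not.\<close>

lemma exp_fs_eq_cutoff:
  assumes "\<epsilon> > 0"
  shows "exp_fs R c e \<epsilon> = cutoff R \<epsilon> (\<lambda>r. c * exp (- e * r) - c * exp (- e * (R - \<epsilon>))) (\<lambda>r. - c * e * exp (- e * r))"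
proof
  fix r
  have "X * ((r - R)^3 / \<epsilon>^2 + (r - R)^2 / \<epsilon>) = \<epsilon> * X * ((r - R) / \<epsilon>)^3 + \<epsilon> * X * ((r - R) / \<epsilon>)^2" for X
    using assms by (simp add: field_simps power2_eq_square power3_eq_cube)
  \<comment> \<open>At \<open>r = R\<close> the two definitions take different branches, and both
    give 0.\<close>
  from this[of "- c * e * exp (- e * (R - \<epsilon>))"]
  show "exp_fs R c e \<epsilon> r = cutoff R \<epsilon> (\<lambda>r. c * exp (- e * r) - c * exp (- e * (R - \<epsilon>))) (\<lambda>r. - c * e * exp (- e * r)) r"
    by (cases "r = R") (simp_all add: exp_fs_def cutoff_def)
qed

lemma linear_fl_eq_cutoff: "linear_fl R a b \<epsilon> = cutoff R \<epsilon> (\<lambda>r. a * r + b) (\<lambda>_. a)"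
  by (auto simp: linear_fl_def cutoff_def fun_eq_iff power_divide algebra_simps)

lemma exp_fl_eq_cutoff:
  "exp_fl R c1 e1 c2 e2 \<epsilon> = cutoff R \<epsilon> (\<lambda>r. c1 * exp (- e1 * r) + c2 * exp (- e2 * r))
    (\<lambda>r. - c1 * e1 * exp (- e1 * r) - c2 * e2 * exp (- e2 * r))"
  by (auto simp: exp_fl_def cutoff_def fun_eq_iff power_divide algebra_simps)


section \<open>The limit of vanishing cutoff width\<close>

lemma continuous_on_interval_bounded:
  fixes f :: "real \<Rightarrow> real"
  assumes "continuous_on UNIV f"
  obtains B where "B > 0" "\<And>x. x \<in> {a..b} \<Longrightarrow> \<bar>f x\<bar> \<le> B"
proof -
  have "bounded (f ` {a..b})"
    using assms by (intro compact_imp_bounded compact_continuous_image) (auto intro: continuous_on_subset)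
  then show ?thesis
    unfolding bounded_pos using that by (auto simp: real_norm_def)
qed

text \<open>Up to \<open>R - \<epsilon>\<close> the profile is uniformly within
  \<open>\<eta> \<epsilon>\<close> of \<open>g0\<close>; the remaining strip has length
  \<open>\<epsilon>\<close> and the integrand stays bounded on it. The profile may vary with
  \<open>\<epsilon>\<close> but not its derivative, which fits an exponential with an additive
  shift.\<close>

lemma integral_cutoff_tendsto:
  assumes "R > 0"
    and deriv: "\<And>\<epsilon> r. (g \<epsilon> has_real_derivative g' r) (at r)" and cont': "continuous_on UNIV g'"
    and cont0: "continuous_on UNIV g0" and cont_u: "continuous_on UNIV u"
    and unif: "\<And>\<epsilon> r. \<bar>g \<epsilon> r - g0 r\<bar> \<le> \<eta> \<epsilon>" and \<eta>: "(\<eta> \<longlongrightarrow> 0) (at_right 0)"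
  shows "((\<lambda>\<epsilon>. integral {0..R} (\<lambda>s. u s * cutoff R \<epsilon> (g \<epsilon>) g' s)) \<longlongrightarrow> integral {0..R} (\<lambda>s. u s * g0 s))
    (at_right 0)"
proof -
  obtain U where U: "U > 0" "\<And>x. x \<in> {0..R} \<Longrightarrow> \<bar>u x\<bar> \<le> U"
    using continuous_on_interval_bounded[OF cont_u, of 0 R] by metis
  obtain G where G: "G > 0" "\<And>x. x \<in> {0..R} \<Longrightarrow> \<bar>g0 x\<bar> \<le> G"
    using continuous_on_interval_bounded[OF cont0, of 0 R] by metis
  obtain K where K: "K > 0" "\<And>x. x \<in> {0..R} \<Longrightarrow> \<bar>g' x\<bar> \<le> K"
    using continuous_on_interval_bounded[OF cont', of 0 R] by metis
  \<comment> \<open>The first summand covers \<open>[0, R - \<epsilon>]\<close>, the second the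
    strip, where \<open>abs_cutoff_le\<close> controls the cubic and \<open>G\<close> controls
    \<open>g0\<close>.\<close>
  define bound where "bound \<epsilon> = U * \<eta> \<epsilon> * (R - \<epsilon>) + U * (2 * \<epsilon> * K + 5 * (G + \<eta> \<epsilon>) + G) * \<epsilon>" for \<epsilon>
  have "((\<lambda>\<epsilon>. integral {0..R} (\<lambda>s. u s * cutoff R \<epsilon> (g \<epsilon>) g' s) - integral {0..R} (\<lambda>s. u s * g0 s)) \<longlongrightarrow> 0)
    (at_right 0)"
  proof (rule Lim_null_comparison)
    have id: "((\<lambda>\<epsilon>. \<epsilon>) \<longlongrightarrow> 0) (at_right (0::real))"
      by (rule tendsto_ident_at)
    have "(bound \<longlongrightarrow> U * 0 * (R - 0) + U * (2 * 0 * K + 5 * (G + 0) + G) * 0) (at_right 0)"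
      unfolding bound_def by (intro tendsto_intros \<eta> id)
    then show "(bound \<longlongrightarrow> 0) (at_right 0)"
      by simp
    have "\<forall>\<^sub>F \<epsilon> in at_right 0. \<epsilon> \<in> {0<..<R}"
      using \<open>R > 0\<close> by (rule eventually_at_right_real)
    then show "\<forall>\<^sub>F \<epsilon> in at_right 0.
        norm (integral {0..R} (\<lambda>s. u s * cutoff R \<epsilon> (g \<epsilon>) g' s) - integral {0..R} (\<lambda>s. u s * g0 s)) \<le> bound \<epsilon>"
    proof eventually_elim
      case (elim \<epsilon>)
      define f where "f s = u s * (cutoff R \<epsilon> (g \<epsilon>) g' s - g0 s)" for s
      have eps: "0 < \<epsilon>" "\<epsilon> < R"
        using elim by auto
      have cont_cut: "continuous_on A (cutoff R \<epsilon> (g \<epsilon>) g')" for A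
        by (rule continuous_on_cutoff[OF eps(1) deriv])
      have cont: "continuous_on A u" "continuous_on A g0" for A
        using cont_u cont0 by (auto intro: continuous_on_subset)
      have cont_f: "continuous_on A f" for A
        unfolding f_def by (intro continuous_intros cont cont_cut)
      have "\<eta> \<epsilon> \<ge> 0"
        using unif[of \<epsilon> 0] by linarith
      have "integral {0..R} (\<lambda>s. u s * cutoff R \<epsilon> (g \<epsilon>) g' s) - integral {0..R} (\<lambda>s. u s * g0 s)
          = integral {0..R} f"
        unfolding f_def right_diff_distrib
        by (intro Henstock_Kurzweil_Integration.integral_diff[symmetric] integrable_continuous_interval
            continuous_intros cont cont_cut)
      also have "\<dots> = integral {0..R - \<epsilon>} f + integral {R - \<epsilon>..R} f"
        using eps by (intro Henstock_Kurzweil_Integration.integral_combine[symmetric]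
            integrable_continuous_interval cont_f) auto
      also have "norm \<dots> \<le> bound \<epsilon>"
        unfolding bound_def
      proof (rule order.trans[OF norm_triangle_ineq add_mono])
        have "norm (integral {0..R - \<epsilon>} f) \<le> U * \<eta> \<epsilon> * (R - \<epsilon> - 0)"
        proof (rule integral_bound)
          fix x assume x: "x \<in> {0..R - \<epsilon>}"
          then show "norm (f x) \<le> U * \<eta> \<epsilon>"
            using U(2)[of x] unif[of \<epsilon> x] eps U(1)
            by (auto simp: f_def cutoff_def abs_mult intro!: mult_mono)
        qed (use eps in \<open>auto intro: cont_f\<close>)
        then show "norm (integral {0..R - \<epsilon>} f) \<le> U * \<eta> \<epsilon> * (R - \<epsilon>)"
          by simp
        have "norm (integral {R - \<epsilon>..R} f) \<le> U * (2 * \<epsilon> * K + 5 * (G + \<eta> \<epsilon>) + G) * (R - (R - \<epsilon>))"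
        proof (rule integral_bound)
          fix x assume x: "x \<in> {R - \<epsilon>..R}"
          have "\<bar>cutoff R \<epsilon> (g \<epsilon>) g' x\<bar> \<le> 2 * \<epsilon> * \<bar>g' (R - \<epsilon>)\<bar> + 5 * \<bar>g \<epsilon> (R - \<epsilon>)\<bar>"
            by (rule abs_cutoff_le[OF eps(1) x])
          also have "\<dots> \<le> 2 * \<epsilon> * K + 5 * (G + \<eta> \<epsilon>)"
            using K(2)[of "R - \<epsilon>"] G(2)[of "R - \<epsilon>"] unif[of \<epsilon> "R - \<epsilon>"] eps
            by (intro add_mono mult_left_mono) auto
          finally have "\<bar>cutoff R \<epsilon> (g \<epsilon>) g' x - g0 x\<bar> \<le> 2 * \<epsilon> * K + 5 * (G + \<eta> \<epsilon>) + G"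
            using G(2)[of x] x eps by auto
          then show "norm (f x) \<le> U * (2 * \<epsilon> * K + 5 * (G + \<eta> \<epsilon>) + G)"
            using U(2)[of x] U(1) x eps by (auto simp: f_def abs_mult intro!: mult_mono)
        qed (use eps in \<open>auto intro: cont_f\<close>)
        then show "norm (integral {R - \<epsilon>..R} f) \<le> U * (2 * \<epsilon> * K + 5 * (G + \<eta> \<epsilon>) + G) * \<epsilon>"
          by simp
      qed
      finally show ?case .
    qed
  qed
  then show ?thesis
    by (simp only: LIM_zero_iff)
qed


section \<open>Signs of sine coefficients\<close>

text \<open>At \<open>1/2\<close> the sine vanishes and the cosine is a sign
  \<open>\<sigma>\<close>, so explicit integration, multiplied by \<open>w * D\<^sup>2\<close>,
  leaves \<open>e * (2 * w\<^sup>2 + \<sigma> * Z)\<close>. The claim reduces to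
  \<open>\<bar>Z\<bar> \<le> 2 * w\<^sup>2\<close>.\<close>

lemma integral_exp_sine_half_nonneg:
  assumes "e > 0" and "m \<ge> 1"
  shows "0 \<le> integral {0..1/2} (\<lambda>s. s * (exp (- e * s) - exp (- e * (1/2))) * sin (2 * pi * real m * s))"
proof -
  define w where "w = 2 * pi * real m"
  define D where "D = e\<^sup>2 + w\<^sup>2"
  define E where "E = exp (- e * (1/2))"
  define \<sigma> where "\<sigma> = cos (w * (1/2))"
  define I where "I = integral {0..1/2} (\<lambda>s. s * (exp (- e * s) - E) * sin (w * s))"
  have w6: "w \<ge> 6"
  proof -
    have "2 * 3 * 1 \<le> 2 * pi * real m"
      using pi_gt3 assms(2) by (intro mult_mono) auto
    then show ?thesis
      by (simp add: w_def)
  qed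
  have half: "sin (w * (1/2)) = 0" "\<bar>\<sigma>\<bar> = 1"
    using sin_npi[of m] cos_npi[of m] by (simp_all add: w_def \<sigma>_def mult.commute power_abs)
  \<comment> \<open>The imaginary part of the antiderivative of \<open>s * exp (z * s)\<close> with
    \<open>z = - e + \<i> * w\<close>, scaled by \<open>D\<^sup>2\<close> to clear the powers of
    \<open>z\<close> from the denominators.\<close>
  let ?F = "\<lambda>s. - exp (- e * s) * ((s * e * D + e\<^sup>2 - w\<^sup>2) * sin (w * s) + (s * w * D + 2 * e * w) * cos (w * s))"
  have 1: "((\<lambda>s. D\<^sup>2 * (s * exp (- e * s) * sin (w * s))) has_integral ?F (1/2) - ?F 0) {0..1/2}"
  proof (rule fundamental_theorem_of_calculus)
    fix x
    have "(?F has_real_derivative D\<^sup>2 * (x * exp (- e * x) * sin (w * x))) (at x)"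
      unfolding D_def
      by (auto intro!: derivative_eq_intros simp: algebra_simps power2_eq_square)
    then show "(?F has_vector_derivative D\<^sup>2 * (x * exp (- e * x) * sin (w * x))) (at x within {0..1/2})"
      unfolding has_real_derivative_iff_has_vector_derivative[symmetric]
      by (rule DERIV_subset) simp
  qed simp
  let ?H = "\<lambda>s. sin (w * s) - w * s * cos (w * s)"
  have 2: "((\<lambda>s. w\<^sup>2 * (s * sin (w * s))) has_integral ?H (1/2) - ?H 0) {0..1/2}"
  proof (rule fundamental_theorem_of_calculus)
    fix x
    have "(?H has_real_derivative w\<^sup>2 * (x * sin (w * x))) (at x)"
      by (auto intro!: derivative_eq_intros simp: algebra_simps power2_eq_square)
    then show "(?H has_vector_derivative w\<^sup>2 * (x * sin (w * x))) (at x within {0..1/2})"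
      unfolding has_real_derivative_iff_has_vector_derivative[symmetric]
      by (rule DERIV_subset) simp
  qed simp
  define X where "X = integral {0..1/2} (\<lambda>s. s * exp (- e * s) * sin (w * s))"
  define Y where "Y = integral {0..1/2} (\<lambda>s. s * sin (w * s))"
  have "I = X - E * Y"
    unfolding I_def X_def Y_def
    by (subst Henstock_Kurzweil_Integration.integral_mult_right[symmetric],
        subst Henstock_Kurzweil_Integration.integral_diff[symmetric])
      (auto intro!: integrable_continuous_interval continuous_intros simp: algebra_simps)
  then have "w * D\<^sup>2 * I = w * (D\<^sup>2 * X) - E * D\<^sup>2 * (w * Y)"
    by (simp only:) (simp only: algebra_simps)
  also have "D\<^sup>2 * X = ?F (1/2) - ?F 0"
    using integral_unique[OF 1] unfolding X_def Henstock_Kurzweil_Integration.integral_mult_right .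
  also have "\<dots> = - E * \<sigma> * (w * D / 2 + 2 * e * w) + 2 * e * w"
    unfolding half E_def[symmetric] \<sigma>_def[symmetric] by (simp add: algebra_simps)
  also have "w * Y = - \<sigma> / 2"
  proof -
    have "w\<^sup>2 * Y = ?H (1/2) - ?H 0"
      using integral_unique[OF 2] unfolding Y_def Henstock_Kurzweil_Integration.integral_mult_right .
    also have "\<dots> = w * (- \<sigma> / 2)"
      unfolding half \<sigma>_def[symmetric] by simp
    finally have "w * (w * Y) = w * (- \<sigma> / 2)"
      by (simp only: power2_eq_square mult.assoc)
    then show ?thesis
      using w6 by (subst (asm) mult_cancel_left) auto
  qed
  finally have "w * D\<^sup>2 * I = w * (- E * \<sigma> * (w * D / 2 + 2 * e * w) + 2 * e * w) - E * D\<^sup>2 * (- \<sigma> / 2)" .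
  also have "\<dots> = e * (2 * w\<^sup>2 + \<sigma> * (E * (e^3 / 2 + e * w\<^sup>2 / 2) - 2 * w\<^sup>2 * E))"
    unfolding D_def by (simp add: field_simps power2_eq_square power3_eq_cube)
  also have "\<dots> \<ge> 0"
  proof -
    have "E > 0" "E \<le> 1"
      using assms(1) by (auto simp: E_def)
    have inv: "E * exp (e / 2) = 1"
      by (simp add: E_def exp_minus)
    have "e / 2 \<le> exp (e / 2)"
      using exp_ge_add_one_self[of "e / 2"] by linarith
    then have "E * (e / 2) \<le> 1"
      using mult_left_mono[of "e / 2" "exp (e / 2)" E] \<open>E > 0\<close> inv by simp
    then have "E * (e / 2) * w\<^sup>2 \<le> 1 * w\<^sup>2"
      by (rule mult_right_mono) simp
    moreover have "E * (e^3 / 2) \<le> w\<^sup>2"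
    proof -
      \<comment> \<open>Squaring the quadratic Taylor bound at \<open>e / 4\<close> yields the cubic
        term \<open>e^3 / 64\<close> below \<open>exp (e / 2)\<close>. Hence
        \<open>E * (e^3 / 2)\<close> is at most 32, which lies below \<open>w\<^sup>2\<close> since
        \<open>w \<ge> 6\<close>.\<close>
      have "1 + e / 4 + (e / 4)\<^sup>2 / 2 \<le> exp (e / 4)"
        using assms(1) by (intro exp_lower_Taylor_quadratic) simp
      then have "(1 + e / 4 + (e / 4)\<^sup>2 / 2)\<^sup>2 \<le> (exp (e / 4))\<^sup>2"
        using assms(1) by (intro power_mono) (auto intro!: add_nonneg_nonneg)
      also have "(exp (e / 4))\<^sup>2 = exp (e / 2)"
        by (simp add: exp_double[symmetric])
      finally have "(1 + e / 4 + (e / 4)\<^sup>2 / 2)\<^sup>2 \<le> exp (e / 2)" .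
      moreover have "e^3 / 64 \<le> (1 + e / 4 + (e / 4)\<^sup>2 / 2)\<^sup>2"
      proof -
        have "(1 + e / 4 + (e / 4)\<^sup>2 / 2)\<^sup>2 = (1 + e / 4)\<^sup>2 + (e / 4)\<^sup>2 + ((e / 4)\<^sup>2 / 2)\<^sup>2 + e^3 / 64"
          by (simp add: power2_eq_square power3_eq_cube field_simps)
        then show ?thesis
          by (simp add: add_nonneg_nonneg)
      qed
      ultimately have "e^3 / 2 \<le> 32 * exp (e / 2)"
        by linarith
      then have "E * (e^3 / 2) \<le> 32 * (E * exp (e / 2))"
        using mult_left_mono[of "e^3 / 2" "32 * exp (e / 2)" E] \<open>E > 0\<close> by (simp add: mult_ac)
      also have "\<dots> \<le> 6\<^sup>2"
        by (simp add: inv)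
      also have "\<dots> \<le> w\<^sup>2"
        using w6 by (intro power_mono) auto
      finally show ?thesis .
    qed
    moreover have "0 \<le> E * (e^3 / 2 + e * w\<^sup>2 / 2)"
      using \<open>E > 0\<close> assms(1) by (intro mult_nonneg_nonneg add_nonneg_nonneg) auto
    moreover have "2 * w\<^sup>2 * E \<le> 2 * w\<^sup>2 * 1"
      using \<open>E \<le> 1\<close> by (intro mult_left_mono) auto
    moreover have "0 \<le> 2 * w\<^sup>2 * E"
      using \<open>E > 0\<close> by simp
    moreover have "E * (e^3 / 2 + e * w\<^sup>2 / 2) = E * (e^3 / 2) + E * (e / 2) * w\<^sup>2"
      by (simp add: distrib_left)
    ultimately have "\<bar>E * (e^3 / 2 + e * w\<^sup>2 / 2) - 2 * w\<^sup>2 * E\<bar> \<le> 2 * w\<^sup>2"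
      unfolding abs_le_iff by linarith
    then have "\<bar>\<sigma> * (E * (e^3 / 2 + e * w\<^sup>2 / 2) - 2 * w\<^sup>2 * E)\<bar> \<le> 2 * w\<^sup>2"
      using half by (simp add: abs_mult)
    then show ?thesis
      using assms(1) by (intro mult_nonneg_nonneg) (simp_all only: abs_le_iff, simp_all)
  qed
  finally have "0 \<le> (w * D\<^sup>2) * I" .
  moreover have "0 < w * D\<^sup>2"
    using w6 assms(1) by (simp add: D_def add_pos_pos)
  ultimately have "0 \<le> I"
    by (simp add: zero_le_mult_iff)
  then show ?thesis
    by (simp add: I_def E_def w_def)
qed

section \<open>Large modes: expansion of sine integrals and choice of the mode\<close>

text \<open>Repeated integration by parts. The explicit terms are the boundary terms up to order
  \<open>w^-3\<close>; the boundary term with \<open>h3\<close> and the integral with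
  \<open>h4\<close> are of order \<open>w^-4\<close> with a constant independent of
  \<open>w\<close>.\<close>

lemma integral_sine_asymptotics:
  fixes h h1 h2 h3 h4 :: "real \<Rightarrow> real"
  assumes "a \<le> b"
    and deriv: "\<And>x. (h has_real_derivative h1 x) (at x)" "\<And>x. (h1 has_real_derivative h2 x) (at x)"
      "\<And>x. (h2 has_real_derivative h3 x) (at x)" "\<And>x. (h3 has_real_derivative h4 x) (at x)"
    and cont: "continuous_on UNIV h4"
  obtains C where "\<And>w. w > 0 \<Longrightarrow>
    \<bar>integral {a..b} (\<lambda>s. h s * sin (w * s))
      - ((- h b * cos (w * b) / w + h1 b * sin (w * b) / w^2 + h2 b * cos (w * b) / w^3)
        - (- h a * cos (w * a) / w + h1 a * sin (w * a) / w^2 + h2 a * cos (w * a) / w^3))\<bar> \<le> C / w^4"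
proof -
  obtain B where B: "B > 0" "\<And>x. x \<in> {a..b} \<Longrightarrow> \<bar>h4 x\<bar> \<le> B"
    using continuous_on_interval_bounded[OF cont, of a b] by metis
  have cont_h: "continuous_on A h" for A
    using deriv(1) DERIV_isCont continuous_at_imp_continuous_on by blast
  have cont4: "continuous_on A h4" for A
    using cont by (rule continuous_on_subset) simp
  show ?thesis
  proof (rule that[of "\<bar>h3 a\<bar> + \<bar>h3 b\<bar> + B * (b - a)"])
    fix w :: real assume w: "w > 0"
    define \<Phi> where "\<Phi> s = - h s * cos (w * s) / w + h1 s * sin (w * s) / w^2 + h2 s * cos (w * s) / w^3" for s
    \<comment> \<open>One boundary term beyond the stated expansion, so that the derivatives
      telescope to the integrand minus a term that already carries \<open>w^-4\<close>.\<close>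
    define \<Psi> where "\<Psi> s = \<Phi> s - h3 s * sin (w * s) / w^4" for s
    have "(\<Psi> has_real_derivative (h x * sin (w * x) - h4 x * sin (w * x) / w^4)) (at x)" for x
    proof -
      have "((\<lambda>s. - h s * cos (w * s) / w) has_real_derivative - h1 x * cos (w * x) / w + h x * sin (w * x)) (at x)"
        using w by (auto intro!: derivative_eq_intros deriv simp: field_simps)
      moreover have "((\<lambda>s. h1 s * sin (w * s) / w^2) has_real_derivative
          h2 x * sin (w * x) / w^2 + h1 x * cos (w * x) / w) (at x)"
        using w by (auto intro!: derivative_eq_intros deriv simp: field_simps power2_eq_square)
      moreover have "((\<lambda>s. h2 s * cos (w * s) / w^3) has_real_derivative
          h3 x * cos (w * x) / w^3 - h2 x * sin (w * x) / w^2) (at x)"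
        using w by (auto intro!: derivative_eq_intros deriv simp: field_simps eval_nat_numeral)
      moreover have "((\<lambda>s. h3 s * sin (w * s) / w^4) has_real_derivative
          h4 x * sin (w * x) / w^4 + h3 x * cos (w * x) / w^3) (at x)"
        using w by (auto intro!: derivative_eq_intros deriv simp: field_simps eval_nat_numeral)
      ultimately have "(\<Psi> has_real_derivative
          (- h1 x * cos (w * x) / w + h x * sin (w * x)) + (h2 x * sin (w * x) / w^2 + h1 x * cos (w * x) / w)
          + (h3 x * cos (w * x) / w^3 - h2 x * sin (w * x) / w^2)
          - (h4 x * sin (w * x) / w^4 + h3 x * cos (w * x) / w^3)) (at x)"
        unfolding \<Psi>_def \<Phi>_def by (intro DERIV_diff DERIV_add)
      then show ?thesis
        by simp
    qed
    then have "((\<lambda>x. h x * sin (w * x) - h4 x * sin (w * x) / w^4) has_integral \<Psi> b - \<Psi> a) {a..b}"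
      using assms(1)
      by (intro fundamental_theorem_of_calculus)
        (simp_all add: has_real_derivative_iff_has_vector_derivative has_vector_derivative_at_within)
    then have "\<Psi> b - \<Psi> a = integral {a..b} (\<lambda>x. h x * sin (w * x) - h4 x * sin (w * x) / w^4)"
      by (simp add: integral_unique)
    also have "\<dots> = integral {a..b} (\<lambda>x. h x * sin (w * x)) - integral {a..b} (\<lambda>x. h4 x * sin (w * x) / w^4)"
      using w by (intro Henstock_Kurzweil_Integration.integral_diff integrable_continuous_interval
          continuous_intros cont_h cont4) auto
    finally have "integral {a..b} (\<lambda>x. h x * sin (w * x)) - (\<Phi> b - \<Phi> a)
        = (h3 a * sin (w * a) / w^4 - h3 b * sin (w * b) / w^4) + integral {a..b} (\<lambda>x. h4 x * sin (w * x) / w^4)"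
      by (simp add: \<Psi>_def)
    also have "\<bar>\<dots>\<bar> \<le> (\<bar>h3 a\<bar> / w^4 + \<bar>h3 b\<bar> / w^4) + B / w^4 * (b - a)"
    proof (rule order.trans[OF abs_triangle_ineq add_mono])
      have "\<bar>y * sin x / w^4\<bar> \<le> \<bar>y\<bar> / w^4" for x y
        using w by (auto simp: abs_mult intro!: divide_right_mono mult_left_le)
      then show "\<bar>h3 a * sin (w * a) / w^4 - h3 b * sin (w * b) / w^4\<bar> \<le> \<bar>h3 a\<bar> / w^4 + \<bar>h3 b\<bar> / w^4"
        by (intro order.trans[OF abs_triangle_ineq4 add_mono])
      have "norm (integral {a..b} (\<lambda>x. h4 x * sin (w * x) / w^4)) \<le> B / w^4 * (b - a)"
      proof (rule integral_bound)
        fix x assume "x \<in> {a..b}"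
        then have "\<bar>h4 x\<bar> * \<bar>sin (w * x)\<bar> \<le> B * 1"
          using B by (intro mult_mono) auto
        then show "norm (h4 x * sin (w * x) / w^4) \<le> B / w^4"
          using w by (simp add: abs_mult divide_right_mono)
      qed (use w assms(1) in \<open>auto intro!: continuous_intros cont4\<close>)
      then show "\<bar>integral {a..b} (\<lambda>x. h4 x * sin (w * x) / w^4)\<bar> \<le> B / w^4 * (b - a)"
        by simp
    qed
    also have "\<dots> = (\<bar>h3 a\<bar> + \<bar>h3 b\<bar> + B * (b - a)) / w^4"
      by (simp add: add_divide_distrib)
    finally show "\<bar>integral {a..b} (\<lambda>s. h s * sin (w * s))
      - ((- h b * cos (w * b) / w + h1 b * sin (w * b) / w^2 + h2 b * cos (w * b) / w^3)
        - (- h a * cos (w * a) / w + h1 a * sin (w * a) / w^2 + h2 a * cos (w * a) / w^3))\<bar>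
      \<le> (\<bar>h3 a\<bar> + \<bar>h3 b\<bar> + B * (b - a)) / w^4"
      by (simp only: \<Phi>_def)
  qed
qed

text \<open>Steps of length \<open>r\<close> cannot jump over an arc of length
  \<open>l \<ge> r\<close>: the first multiple of \<open>r\<close> past the left end
  \<open>a + k\<close> still lies in the arc.\<close>

lemma rotation_hits_arc:
  fixes r a l :: real
  assumes "0 < r" "r \<le> l"
  obtains n k :: nat where "n \<ge> M" "a + real k \<le> real n * r" "real n * r \<le> a + real k + l"
proof -
  \<comment> \<open>A large \<open>k\<close> moves the arc so far out that reaching it takes at
    least \<open>M\<close> steps.\<close>
  obtain k :: nat where k: "real k \<ge> real M * r + \<bar>a\<bar>"
    using real_arch_simple by blast
  define n where "n = nat \<lceil>(a + real k) / r\<rceil>"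
  have "(a + real k) / r \<ge> 0"
    using k assms mult_nonneg_nonneg[of "real M" r] by (intro divide_nonneg_pos) linarith+
  then have n: "real n \<ge> (a + real k) / r" "real n < (a + real k) / r + 1"
    unfolding n_def by linarith+
  have "real M \<le> (a + real k) / r"
    using k assms by (simp add: pos_le_divide_eq)
  then have "n \<ge> M"
    using n by linarith
  moreover have "a + real k \<le> real n * r"
    using n(1) assms by (simp add: field_simps)
  moreover have "real n * r \<le> a + real k + l"
    using n(2) assms by (simp add: field_simps)
  ultimately show ?thesis
    by (rule that)
qed

lemma sin_ge_sin_endpoint:
  assumes "0 \<le> x" "x \<le> pi / 2" "x \<le> \<theta>" "\<theta> \<le> pi - x"
  shows "sin x \<le> sin \<theta>"
proof (cases "\<theta> \<le> pi / 2")
  case True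
  then show ?thesis
    using assms by (intro sin_monotone_2pi_le) auto
next
  case False
  then have "sin x \<le> sin (pi - \<theta>)"
    using assms by (intro sin_monotone_2pi_le) auto
  then show ?thesis
    by simp
qed

text \<open>\<open>h\<close> vanishes at both ends, so the expansion starts with
  \<open>h1 R * sin (w * R) / w^2\<close>, where \<open>h1 R = - \<kappa>\<close> is the slope at
  the kink. For modes with \<open>sin (w * R) \<ge> \<delta>\<close> this term beats the rest once
  \<open>m\<close> is large.\<close>

lemma exists_mode_sine_integral_neg:
  fixes R c e :: real
  assumes "0 < R" "R < 1/2" "c > 0" "e > 0"
  shows "\<exists>m\<ge>1. integral {0..R} (\<lambda>s. s * (c * exp (- e * s) - c * exp (- e * R)) * sin (2 * pi * real m * s)) < 0"
proof -
  define E where "E = exp (- e * R)"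
  define h where "h s = s * (c * exp (- e * s) - c * E)" for s
  define h1 where "h1 s = c * exp (- e * s) * (1 - e * s) - c * E" for s
  define h2 where "h2 s = c * e * exp (- e * s) * (e * s - 2)" for s
  define h3 where "h3 s = c * e^2 * exp (- e * s) * (3 - e * s)" for s
  define h4 where "h4 s = c * e^3 * exp (- e * s) * (e * s - 4)" for s
  have deriv: "(h has_real_derivative h1 x) (at x)" "(h1 has_real_derivative h2 x) (at x)"
    "(h2 has_real_derivative h3 x) (at x)" "(h3 has_real_derivative h4 x) (at x)" for x
    unfolding h_def h1_def h2_def h3_def h4_def
    by (auto intro!: derivative_eq_intros simp: algebra_simps power2_eq_square power3_eq_cube)
  have "continuous_on UNIV h4"
    unfolding h4_def by (intro continuous_intros)
  then obtain C where C: "\<And>w. w > 0 \<Longrightarrow>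
    \<bar>integral {0..R} (\<lambda>s. h s * sin (w * s))
      - ((- h R * cos (w * R) / w + h1 R * sin (w * R) / w^2 + h2 R * cos (w * R) / w^3)
        - (- h 0 * cos (w * 0) / w + h1 0 * sin (w * 0) / w^2 + h2 0 * cos (w * 0) / w^3))\<bar> \<le> C / w^4"
    using integral_sine_asymptotics[OF less_imp_le[OF assms(1)] deriv] by blast
  \<comment> \<open>With this choice the arc from \<open>\<eta>\<close> to
    \<open>1/2 - \<eta>\<close> has length exactly \<open>R\<close>, the step of the rotation, and
    it stays away from the zeros of the sine.\<close>
  define \<eta> where "\<eta> = (1/2 - R) / 2"
  define \<delta> where "\<delta> = sin (2 * pi * \<eta>)"
  have \<eta>: "0 < \<eta>" "\<eta> < 1/4" "R \<le> 1/2 - 2 * \<eta>"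
    using assms by (auto simp: \<eta>_def field_simps)
  have \<eta>': "2 * pi * \<eta> \<le> pi / 2"
    using \<eta>(2) by (simp add: field_simps)
  have "\<delta> > 0"
    unfolding \<delta>_def
    by (rule sin_gt_zero) (use \<eta>(1) in simp, use \<eta>' pi_gt_zero in linarith)
  define \<kappa> where "\<kappa> = c * e * R * E"
  have "\<kappa> > 0"
    using assms by (simp add: \<kappa>_def E_def)
  \<comment> \<open>\<open>Q\<close> bounds all terms other than the leading one after
    multiplication by \<open>w^3\<close>; \<open>M\<close> is chosen such that
    \<open>\<kappa> * \<delta> * w\<close> exceeds it.\<close>
  define Q where "Q = \<bar>h2 R\<bar> + \<bar>h2 0\<bar> + \<bar>C\<bar>"
  obtain M :: nat where M: "real M > Q / (\<kappa> * \<delta>)"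
    using reals_Archimedean2 by blast
  obtain m k :: nat where m: "m \<ge> max 1 M" and lower: "\<eta> + real k \<le> real m * R"
    and upper: "real m * R \<le> \<eta> + real k + (1/2 - 2 * \<eta>)"
    using rotation_hits_arc[of R "1/2 - 2 * \<eta>" "max 1 M" \<eta>] assms(1) \<eta>(3) by metis
  define w where "w = 2 * pi * real m"
  have wm: "w \<ge> real m" "w \<ge> 1"
  proof -
    have "1 * real m \<le> (2 * pi) * real m"
      using pi_gt3 by (intro mult_right_mono) auto
    then show "w \<ge> real m"
      by (simp add: w_def)
    then show "w \<ge> 1"
      using m by linarith
  qed
  have "sin (w * R) \<ge> \<delta>"
  proof -
    define \<theta> where "\<theta> = 2 * pi * (real m * R - real k)"
    have "w * R = \<theta> + 2 * real k * pi"
      by (simp add: w_def \<theta>_def algebra_simps)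
    then have "sin (w * R) = sin \<theta>"
      by (simp only: sin_add cos_2npi sin_2npi)
    moreover have "2 * pi * \<eta> \<le> \<theta>"
      unfolding \<theta>_def using lower by (intro mult_left_mono) auto
    moreover have "\<theta> \<le> 2 * pi * (1/2 - \<eta>)"
      unfolding \<theta>_def using upper by (intro mult_left_mono) auto
    then have "\<theta> \<le> pi - 2 * pi * \<eta>"
      by (simp add: algebra_simps)
    ultimately show ?thesis
      unfolding \<delta>_def using \<eta>(1) \<eta>' sin_ge_sin_endpoint[of "2 * pi * \<eta>" \<theta>] by simp
  qed
  have "w > 0"
    using wm by linarith
  have hR: "h R = 0" "h1 R = - \<kappa>" "h 0 = 0"
    by (simp_all add: h_def h1_def \<kappa>_def E_def algebra_simps)
  define I where "I = integral {0..R} (\<lambda>s. h s * sin (w * s))"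
  have "I \<le> (h1 R * sin (w * R) / w^2 + h2 R * cos (w * R) / w^3 - h2 0 / w^3) + C / w^4"
    using C[OF \<open>w > 0\<close>] hR unfolding abs_le_iff I_def by simp
  then have "w^3 * I \<le> w^3 * ((h1 R * sin (w * R) / w^2 + h2 R * cos (w * R) / w^3 - h2 0 / w^3) + C / w^4)"
    using \<open>w > 0\<close> by (intro mult_left_mono) auto
  also have "\<dots> = - \<kappa> * w * sin (w * R) + h2 R * cos (w * R) - h2 0 + C / w"
    using \<open>w > 0\<close> by (simp add: hR eval_nat_numeral field_simps)
  also have "\<dots> \<le> - \<kappa> * w * \<delta> + \<bar>h2 R\<bar> + \<bar>h2 0\<bar> + \<bar>C\<bar>"
  proof -
    have "\<kappa> * w * \<delta> \<le> \<kappa> * w * sin (w * R)"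
      using \<open>\<kappa> > 0\<close> \<open>w > 0\<close> \<open>sin (w * R) \<ge> \<delta>\<close> by (intro mult_left_mono) auto
    moreover have "h2 R * cos (w * R) \<le> \<bar>h2 R\<bar>"
    proof -
      have "\<bar>h2 R * cos (w * R)\<bar> \<le> \<bar>h2 R\<bar>"
        by (simp add: abs_mult mult_left_le)
      then show ?thesis by linarith
    qed
    moreover have "C / w \<le> \<bar>C\<bar>"
    proof -
      have "C / w \<le> \<bar>C\<bar> / w"
        using \<open>w > 0\<close> by (intro divide_right_mono) auto
      also have "\<dots> \<le> \<bar>C\<bar> / 1"
        using wm by (intro divide_left_mono) auto
      finally show ?thesis by simp
    qed
    ultimately show ?thesis
      by linarith
  qed
  also have "\<dots> = Q - \<kappa> * \<delta> * w"
    by (simp add: Q_def)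
  also have "\<dots> < 0"
  proof -
    have "Q / (\<kappa> * \<delta>) < w"
      using M m wm by linarith
    then show ?thesis
      using \<open>\<kappa> > 0\<close> \<open>\<delta> > 0\<close> by (simp add: field_simps)
  qed
  finally have "I < 0"
    using \<open>w > 0\<close> by (simp add: mult_less_0_iff)
  moreover have "m \<ge> 1"
    using m by simp
  ultimately show ?thesis
    unfolding I_def h_def E_def w_def by blast
qed

lemma cos_nonneg_near_multiple:
  assumes "\<bar>x - real k\<bar> \<le> 1/4"
  shows "0 \<le> cos (2 * pi * x)"
proof -
  define \<theta> where "\<theta> = 2 * pi * (x - real k)"
  have "2 * pi * x = \<theta> + 2 * real k * pi"
    by (simp add: \<theta>_def algebra_simps)
  then have "cos (2 * pi * x) = cos \<theta>"
    by (simp only: cos_add cos_2npi sin_2npi)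
  moreover have "\<bar>\<theta>\<bar> \<le> 2 * pi * (1/4)"
    unfolding \<theta>_def abs_mult using assms by (intro mult_mono) auto
  then have "0 \<le> cos \<theta>"
    by (intro cos_ge_zero) auto
  ultimately show ?thesis
    by simp
qed

text \<open>The coefficient of \<open>w\<^sup>-\<^sup>3\<close> in the expansion comes from the jumps of the second derivative at
  \<open>1/2 - \<epsilon>\<close> and \<open>1/2\<close>, which are of size \<open>1/\<epsilon>\<close>; the mode is even so that the latter enters with a
  negative sign, and \<open>m * \<epsilon>\<close> is near an integer so that the former does too.\<close>

lemma exists_mode_sine_integral_cutoff_neg:
  fixes c e \<epsilon> :: real
  assumes "c > 0" "e > 0" "\<epsilon> > 0" "\<epsilon> \<le> 1/4" "\<epsilon> * e < 4" "2 * \<epsilon> < exp (- e / 2)"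
  shows "\<exists>m\<ge>1. integral {0..1/2} (\<lambda>s. s * cutoff (1/2) \<epsilon>
    (\<lambda>r. c * exp (- e * r) - c * exp (- e * (1/2 - \<epsilon>))) (\<lambda>r. - c * e * exp (- e * r)) s * sin (2 * pi * real m * s)) < 0"
proof -
  define p where "p = 1/2 - \<epsilon>"
  define E where "E = exp (- e * p)"
  define f where "f = cutoff (1/2) \<epsilon> (\<lambda>r. c * exp (- e * r) - c * E) (\<lambda>r. - c * e * exp (- e * r))"
  define h where "h s = s * (c * exp (- e * s) - c * E)" for s
  define h1 where "h1 s = c * exp (- e * s) * (1 - e * s) - c * E" for s
  define h2 where "h2 s = c * e * exp (- e * s) * (e * s - 2)" for s
  define h3 where "h3 s = c * e^2 * exp (- e * s) * (3 - e * s)" for s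
  define h4 where "h4 s = c * e^3 * exp (- e * s) * (e * s - 4)" for s
  have deriv_h: "(h has_real_derivative h1 x) (at x)" "(h1 has_real_derivative h2 x) (at x)"
    "(h2 has_real_derivative h3 x) (at x)" "(h3 has_real_derivative h4 x) (at x)" for x
    unfolding h_def h1_def h2_def h3_def h4_def
    by (auto intro!: derivative_eq_intros simp: algebra_simps power2_eq_square power3_eq_cube)
  define A where "A = - c * e * E / \<epsilon>^2"
  \<comment> \<open>\<open>k s\<close> is \<open>s\<close> times the force coefficient on the cutoff
    strip, and \<open>h s\<close> is the same product to the left of the strip.\<close>
  define k where "k s = A * (s * ((s - 1/2)^3 + \<epsilon> * (s - 1/2)^2))" for s
  define k1 where "k1 s = A * ((s - 1/2)^3 + \<epsilon> * (s - 1/2)^2 + s * (3 * (s - 1/2)^2 + 2 * \<epsilon> * (s - 1/2)))" for s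
  define k2 where "k2 s = A * (2 * (3 * (s - 1/2)^2 + 2 * \<epsilon> * (s - 1/2)) + s * (6 * (s - 1/2) + 2 * \<epsilon>))" for s
  define k3 where "k3 s = A * (3 * (6 * (s - 1/2) + 2 * \<epsilon>) + 6 * s)" for s
  define k4 where "k4 s = 24 * A" for s :: real
  have deriv_k: "(k has_real_derivative k1 x) (at x)" "(k1 has_real_derivative k2 x) (at x)"
    "(k2 has_real_derivative k3 x) (at x)" "(k3 has_real_derivative k4 x) (at x)" for x
    unfolding k_def k1_def k2_def k3_def k4_def
    by (auto intro!: derivative_eq_intros simp: algebra_simps power2_eq_square power3_eq_cube)
  have p: "0 < p" "p < 1/2"
    using assms by (auto simp: p_def)
  have "continuous_on UNIV h4"
    unfolding h4_def by (intro continuous_intros)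
  then obtain C1 where C1: "\<And>w. w > 0 \<Longrightarrow>
    \<bar>integral {0..p} (\<lambda>s. h s * sin (w * s))
      - ((- h p * cos (w * p) / w + h1 p * sin (w * p) / w^2 + h2 p * cos (w * p) / w^3)
        - (- h 0 * cos (w * 0) / w + h1 0 * sin (w * 0) / w^2 + h2 0 * cos (w * 0) / w^3))\<bar> \<le> C1 / w^4"
    using integral_sine_asymptotics[OF less_imp_le[OF p(1)] deriv_h] by blast
  have "continuous_on UNIV k4"
    unfolding k4_def by (intro continuous_intros)
  then obtain C2 where C2: "\<And>w. w > 0 \<Longrightarrow>
    \<bar>integral {p..1/2} (\<lambda>s. k s * sin (w * s))
      - ((- k (1/2) * cos (w * (1/2)) / w + k1 (1/2) * sin (w * (1/2)) / w^2 + k2 (1/2) * cos (w * (1/2)) / w^3)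
        - (- k p * cos (w * p) / w + k1 p * sin (w * p) / w^2 + k2 p * cos (w * p) / w^3))\<bar> \<le> C2 / w^4"
    using integral_sine_asymptotics[OF less_imp_le[OF p(2)] deriv_k] by blast
  have bounds: "E > 0" "2 * \<epsilon> < E"
  proof -
    show "E > 0"
      by (simp add: E_def)
    have "exp (- e / 2) \<le> E"
      using assms by (simp add: E_def p_def algebra_simps)
    then show "2 * \<epsilon> < E"
      using assms by linarith
  qed
  \<comment> \<open>\<open>- \<kappa>\<close> is \<open>k2 (1/2) - h2 0\<close>, the jump at
    \<open>1/2\<close> together with the boundary term at 0. It is negative because
    \<open>2 * \<epsilon> < E\<close>.\<close>
  define \<kappa> where "\<kappa> = c * e * (E / \<epsilon> - 2)"
  have "\<kappa> > 0"
    using assms bounds by (simp add: \<kappa>_def field_simps)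
  obtain M :: nat where M: "real M > (\<bar>C1\<bar> + \<bar>C2\<bar>) / \<kappa>"
    using reals_Archimedean2 by blast
  \<comment> \<open>Rotation by \<open>2 * \<epsilon>\<close>, at most \<open>1/2\<close>, hits the
    arc of length \<open>1/2\<close> centred at the integers; with \<open>m = 2 * n\<close> this
    puts \<open>m * \<epsilon>\<close> within \<open>1/4\<close> of an integer.\<close>
  obtain n j :: nat where n: "n \<ge> max 1 M" and lower: "- (1/4) + real j \<le> real n * (2 * \<epsilon>)"
    and upper: "real n * (2 * \<epsilon>) \<le> - (1/4) + real j + 1/2"
    using rotation_hits_arc[of "2 * \<epsilon>" "1/2" "max 1 M" "- (1/4)"] assms by auto
  define m where "m = 2 * n"
  define w where "w = 2 * pi * real m"
  have wn: "w \<ge> real n" "w \<ge> 1"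
  proof -
    have "1 * real n \<le> (4 * pi) * real n"
      using pi_gt3 by (intro mult_right_mono) auto
    then show "w \<ge> real n"
      by (simp add: w_def m_def)
    then show "w \<ge> 1"
      using n by linarith
  qed
  then have "w > 0"
    by linarith
  have half: "cos (w * (1/2)) = 1" "sin (w * (1/2)) = 0"
  proof -
    have "w * (1/2) = 2 * real n * pi"
      by (simp add: w_def m_def)
    then show "cos (w * (1/2)) = 1" "sin (w * (1/2)) = 0"
      by (simp_all only: cos_2npi sin_2npi)
  qed
  have cos_p: "cos (w * p) \<ge> 0"
  proof -
    have "w * p = w * (1/2) - w * \<epsilon>"
      by (simp add: p_def algebra_simps)
    then have "cos (w * p) = cos (w * \<epsilon>)"
      by (simp only: cos_diff half mult_1 mult_zero_left add_0_right)
    also have "w * \<epsilon> = 2 * pi * (real n * (2 * \<epsilon>))"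
      by (simp add: w_def m_def)
    also have "cos \<dots> \<ge> 0"
      using lower upper by (intro cos_nonneg_near_multiple[of _ j]) (simp only: abs_le_iff, linarith)
    finally show ?thesis .
  qed
  define I where "I = integral {0..1/2} (\<lambda>s. s * f s * sin (w * s))"
  have cont_f: "continuous_on S f" for S
    unfolding f_def by (rule continuous_on_cutoff) (use assms in \<open>auto intro!: derivative_eq_intros\<close>)
  have "I = integral {0..p} (\<lambda>s. s * f s * sin (w * s)) + integral {p..1/2} (\<lambda>s. s * f s * sin (w * s))"
    unfolding I_def using p
    by (intro Henstock_Kurzweil_Integration.integral_combine[symmetric] integrable_continuous_interval
        continuous_intros cont_f) auto
  also have "integral {0..p} (\<lambda>s. s * f s * sin (w * s)) = integral {0..p} (\<lambda>s. h s * sin (w * s))"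
    by (rule Henstock_Kurzweil_Integration.integral_cong) (simp add: f_def h_def cutoff_def p_def)
  also have "integral {p..1/2} (\<lambda>s. s * f s * sin (w * s)) = integral {p..1/2} (\<lambda>s. k s * sin (w * s))"
  proof (rule Henstock_Kurzweil_Integration.integral_cong)
    fix s assume s: "s \<in> {p..1/2}"
    have "f s = A * ((s - 1/2)^3 + \<epsilon> * (s - 1/2)^2)"
    proof (cases "s = p")
      case True
      then show ?thesis
        by (simp add: f_def cutoff_def p_def E_def A_def power2_eq_square power3_eq_cube)
    next
      case False
      then have "f s = \<epsilon> * (- c * e * E) * ((s - 1/2) / \<epsilon>)^3 + \<epsilon> * (- c * e * E) * ((s - 1/2) / \<epsilon>)^2"
        using s by (simp add: f_def cutoff_def p_def E_def)
      also have "\<epsilon> * X * (y / \<epsilon>)^3 + \<epsilon> * X * (y / \<epsilon>)^2 = X / \<epsilon>^2 * (y^3 + \<epsilon> * y^2)" for X y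
        using assms(3) by (simp add: field_simps power2_eq_square power3_eq_cube)
      finally show ?thesis
        by (simp add: A_def)
    qed
    then show "s * f s * sin (w * s) = k s * sin (w * s)"
      by (simp add: k_def)
  qed
  finally have I: "I = integral {0..p} (\<lambda>s. h s * sin (w * s)) + integral {p..1/2} (\<lambda>s. k s * sin (w * s))" .
  have A\<epsilon>: "A * \<epsilon>^2 = - c * e * E"
    using assms(3) by (simp add: A_def)
  \<comment> \<open>Values and slopes match at both ends of the strip, so the terms of order
    \<open>w^-1\<close> and \<open>w^-2\<close> cancel and \<open>T\<close> collects those of order
    \<open>w^-3\<close>.\<close>
  have vals: "h p = 0" "h 0 = 0" "k (1/2) = 0" "k1 (1/2) = 0" "k p = 0"
    by (simp_all add: h_def E_def k_def k1_def p_def power2_eq_square power3_eq_cube)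
  have "k1 p = A * \<epsilon>^2 * p"
    by (simp add: k1_def p_def algebra_simps power2_eq_square power3_eq_cube)
  then have kh1: "k1 p = h1 p"
    unfolding A\<epsilon> h1_def E_def by (simp add: algebra_simps)
  define T where "T = (h2 p - k2 p) * cos (w * p) + k2 (1/2) - h2 0"
  have "I \<le> (h1 p * sin (w * p) / w^2 + h2 p * cos (w * p) / w^3 - h2 0 / w^3 + C1 / w^4)
      + (k2 (1/2) / w^3 - (h1 p * sin (w * p) / w^2 + k2 p * cos (w * p) / w^3) + C2 / w^4)"
    using C1[OF \<open>w > 0\<close>] C2[OF \<open>w > 0\<close>] unfolding I vals half kh1 abs_le_iff by simp
  then have "w^3 * I \<le> w^3 * \<dots>"
    using \<open>w > 0\<close> by (intro mult_left_mono) auto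
  also have "\<dots> = T + (C1 + C2) / w"
    using \<open>w > 0\<close> by (simp add: T_def eval_nat_numeral field_simps)
  also have "\<dots> \<le> - \<kappa> + (\<bar>C1\<bar> + \<bar>C2\<bar>) / w"
  proof (intro add_mono divide_right_mono)
    \<comment> \<open>The jump of the second derivative at \<open>p\<close>; its sign comes from
      \<open>\<epsilon> * e < 4\<close>.\<close>
    have "h2 p - k2 p = c * e * E * p * (e - 4 / \<epsilon>)"
    proof -
      have "k2 p = A * \<epsilon>^2 * (2 - 4 * p / \<epsilon>)"
        using assms(3) by (simp add: k2_def p_def power2_eq_square field_simps)
      then show ?thesis
        unfolding A\<epsilon> h2_def E_def by (simp add: algebra_simps)
    qed
    moreover have "e - 4 / \<epsilon> \<le> 0"
      using assms by (simp add: field_simps)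
    ultimately have "h2 p - k2 p \<le> 0"
      using assms bounds p by (simp add: mult_nonneg_nonpos)
    then have "(h2 p - k2 p) * cos (w * p) \<le> 0"
      using cos_p by (rule mult_nonpos_nonneg)
    moreover have "k2 (1/2) = - c * e * E / \<epsilon>"
      using assms(3) by (simp add: k2_def A_def power2_eq_square field_simps)
    moreover have "h2 0 = - (2 * c * e)"
      by (simp add: h2_def)
    ultimately show "T \<le> - \<kappa>"
      by (simp add: T_def \<kappa>_def algebra_simps)
  qed (use \<open>w > 0\<close> in auto)
  also have "\<dots> < 0"
  proof -
    have "(\<bar>C1\<bar> + \<bar>C2\<bar>) / \<kappa> < w"
      using M n wn by linarith
    then show ?thesis
      using \<open>\<kappa> > 0\<close> \<open>w > 0\<close> by (simp add: field_simps)
  qed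
  finally have "I < 0"
    using \<open>w > 0\<close> by (simp add: mult_less_0_iff)
  moreover have "m \<ge> 1"
    using n by (simp add: m_def)
  ultimately show ?thesis
    unfolding I_def f_def E_def p_def w_def by blast
qed


section \<open>Stability and instability\<close>

text \<open>Treats both kinds of normal coefficient at once: a cutoff of a profile independent of
  \<open>\<epsilon>\<close>, with the sign that the first eigenvalue needs for stability at
  \<open>R = 1/2\<close>.\<close>

lemma normal_coefficient_cutoff:
  fixes fl :: "real \<Rightarrow> real \<Rightarrow> real"
  assumes "R > 0" and "is_linear_fl R fl \<or> is_exp_fl R fl"
  obtains g g' where "\<And>r. (g has_real_derivative g' r) (at r)" "continuous_on UNIV g'"
    "\<And>\<epsilon>. fl \<epsilon> = cutoff R \<epsilon> g g'"
    "\<And>m. R = 1/2 \<Longrightarrow> m \<ge> 1 \<Longrightarrow> integral {0..R} (\<lambda>s. (1 - cos (2 * pi * real m * s)) * g s) \<le> 0"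
  using assms(2)
proof
  assume "is_linear_fl R fl"
  then obtain a b where ab: "a < 0" "b > 0" "a \<le> - (2 * b / R)" "fl = linear_fl R a b"
    unfolding is_linear_fl_def by blast
  show ?thesis
  proof (rule that[of "\<lambda>r. a * r + b" "\<lambda>_. a"])
    fix m :: nat assume R: "R = 1/2" and "m \<ge> 1"
    define w where "w = 2 * pi * real m"
    have "w > 0"
      using \<open>m \<ge> 1\<close> by (simp add: w_def)
    have half: "sin (w * (1/2)) = 0" "cos (w * (1/2)) \<le> 1"
      using sin_npi[of m] cos_le_one by (simp_all only: w_def) (simp add: mult.commute)
    let ?F = "\<lambda>s. a * s^2 / 2 + b * s - (a * s + b) * sin (w * s) / w - a * cos (w * s) / w^2"
    have "((\<lambda>s. (1 - cos (w * s)) * (a * s + b)) has_integral ?F (1/2) - ?F 0) {0..1/2}"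
    proof (rule fundamental_theorem_of_calculus)
      fix x
      have "(?F has_real_derivative (1 - cos (w * x)) * (a * x + b)) (at x)"
        using \<open>w > 0\<close> by (auto intro!: derivative_eq_intros simp: field_simps power2_eq_square)
      then show "(?F has_vector_derivative (1 - cos (w * x)) * (a * x + b)) (at x within {0..1/2})"
        unfolding has_real_derivative_iff_has_vector_derivative[symmetric]
        by (rule DERIV_subset) simp
    qed simp
    then have "integral {0..1/2} (\<lambda>s. (1 - cos (w * s)) * (a * s + b)) = ?F (1/2) - ?F 0"
      by (rule integral_unique)
    \<comment> \<open>\<open>a / 8 + b / 2\<close> is the integral of the profile itself; at
      \<open>R = 1/2\<close> the assumption on the slope reads \<open>a \<le> - 4 * b\<close>, which
      makes it nonpositive.\<close>
    also have "\<dots> = (a / 8 + b / 2) + (a / w^2) * (1 - cos (w * (1/2)))"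
      unfolding half by (simp add: power2_eq_square diff_divide_distrib right_diff_distrib)
    also have "\<dots> \<le> 0"
    proof (rule add_nonpos_nonpos)
      show "a / 8 + b / 2 \<le> 0"
        using ab(3) R by simp
      show "(a / w^2) * (1 - cos (w * (1/2))) \<le> 0"
        using ab(1) half(2) by (intro mult_nonpos_nonneg divide_nonpos_nonneg) auto
    qed
    finally show "integral {0..R} (\<lambda>s. (1 - cos (2 * pi * real m * s)) * (a * s + b)) \<le> 0"
      unfolding R w_def .
  qed (auto intro!: derivative_eq_intros simp: ab(4) linear_fl_eq_cutoff)
next
  assume "is_exp_fl R fl"
  then obtain c1 e1 c2 e2 where fl: "fl = exp_fl R c1 e1 c2 e2"
    and neg: "\<forall>\<^sub>F \<epsilon> in at_right 0. \<forall>m\<ge>(1::nat).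
        integral {0..R - \<epsilon>} (\<lambda>s. fl \<epsilon> s * (1 - cos (2 * pi * real m * s))) \<le> 0"
    unfolding is_exp_fl_def by blast
  define g where "g r = c1 * exp (- e1 * r) + c2 * exp (- e2 * r)" for r
  define g' where "g' r = - c1 * e1 * exp (- e1 * r) - c2 * e2 * exp (- e2 * r)" for r
  have fl_cutoff: "fl \<epsilon> = cutoff R \<epsilon> g g'" for \<epsilon>
    unfolding fl exp_fl_eq_cutoff g_def[abs_def] g'_def[abs_def] ..
  show ?thesis
  proof (rule that[of g g'])
    fix m :: nat assume "m \<ge> 1"
    define f where "f s = (1 - cos (2 * pi * real m * s)) * g s" for s
    have "continuous_on {0..R} f"
      unfolding f_def g_def by (intro continuous_intros)
    \<comment> \<open>The assumed sign concerns integrals up to \<open>R - \<epsilon>\<close>, where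
      the coefficient equals \<open>g\<close>; continuity in the upper limit carries it over to
      \<open>R\<close>.\<close>
    then have "continuous_on {0..R} (\<lambda>x. integral {0..x} f)"
      by (intro indefinite_integral_continuous_1 integrable_continuous_interval)
    then have "((\<lambda>x. integral {0..x} f) \<longlongrightarrow> integral {0..R} f) (at R within {0..R})"
      using assms(1) by (simp add: continuous_on_def)
    moreover have "filterlim (\<lambda>\<epsilon>. R - \<epsilon>) (at R within {0..R}) (at_right 0)"
      unfolding filterlim_at
    proof
      have "\<forall>\<^sub>F \<epsilon> in at_right 0. \<epsilon> \<in> {0<..<R}"
        using assms(1) by (rule eventually_at_right_real)
      then show "\<forall>\<^sub>F \<epsilon> in at_right 0. R - \<epsilon> \<in> {0..R} \<and> R - \<epsilon> \<noteq> R"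
        by eventually_elim auto
      have "((\<lambda>\<epsilon>. R - \<epsilon>) \<longlongrightarrow> R - 0) (at_right 0)"
        by (intro tendsto_intros)
      then show "((\<lambda>\<epsilon>. R - \<epsilon>) \<longlongrightarrow> R) (at_right 0)"
        by simp
    qed
    ultimately have "((\<lambda>\<epsilon>. integral {0..R - \<epsilon>} f) \<longlongrightarrow> integral {0..R} f) (at_right 0)"
      by (rule filterlim_compose)
    moreover have "\<forall>\<^sub>F \<epsilon> in at_right 0. integral {0..R - \<epsilon>} f \<le> 0"
      using neg
    proof eventually_elim
      case (elim \<epsilon>)
      have "integral {0..R - \<epsilon>} f = integral {0..R - \<epsilon>} (\<lambda>s. fl \<epsilon> s * (1 - cos (2 * pi * real m * s)))"
        by (rule Henstock_Kurzweil_Integration.integral_cong) (simp add: f_def fl_cutoff cutoff_def)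
      then show ?case
        using elim \<open>m \<ge> 1\<close> by simp
    qed
    ultimately have "integral {0..R} f \<le> 0"
      by (rule tendsto_upperbound) simp
    then show "integral {0..R} (\<lambda>s. (1 - cos (2 * pi * real m * s)) * g s) \<le> 0"
      unfolding f_def[abs_def] .
  qed (auto intro!: derivative_eq_intros continuous_intros simp: fl_cutoff g_def[abs_def] g'_def[abs_def])
qed

theorem theorem4p12:
  fixes R c e :: real and fl fs :: "real \<Rightarrow> real \<Rightarrow> real"
  assumes "0 < R" and "R \<le> 1/2"
    and "c > 0" and "e > 0"
    and "fs = exp_fs R c e"
    and "is_linear_fl R fl \<or> is_exp_fl R fl"
  shows "(\<forall>\<epsilon> N. 0 < \<epsilon> \<and> \<epsilon> < R \<and> N \<ge> 1 \<longrightarrow> steady_state (fl \<epsilon>) (fs \<epsilon>) N (vertical_line N))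
    \<and> (R = 1/2 \<longrightarrow> stable_line_eps_limit fl fs)
    \<and> (R < 1/2 \<longrightarrow> unstable_line_eps_limit fl fs)
    \<and> (\<forall>\<^sub>F \<epsilon> in at_right 0. unstable_line (fl \<epsilon>) (fs \<epsilon>))"
proof -
  obtain g g' where g: "\<And>r. (g has_real_derivative g' r) (at r)" "continuous_on UNIV g'"
    and fl: "\<And>\<epsilon>. fl \<epsilon> = cutoff R \<epsilon> g g'"
    and g_half: "\<And>m. R = 1/2 \<Longrightarrow> m \<ge> 1 \<Longrightarrow> integral {0..R} (\<lambda>s. (1 - cos (2 * pi * real m * s)) * g s) \<le> 0"
    using normal_coefficient_cutoff[OF assms(1,6)] by blast
  define h where "h \<epsilon> r = c * exp (- e * r) - c * exp (- e * (R - \<epsilon>))" for \<epsilon> r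
  define h' where "h' r = - c * e * exp (- e * r)" for r
  define h0 where "h0 r = c * exp (- e * r) - c * exp (- e * R)" for r
  have fs: "fs \<epsilon> = cutoff R \<epsilon> (h \<epsilon>) h'" if "\<epsilon> > 0" for \<epsilon>
    unfolding assms(5) exp_fs_eq_cutoff[OF that] h_def[abs_def] h'_def[abs_def] ..
  have h: "(h \<epsilon> has_real_derivative h' r) (at r)" for \<epsilon> r
    unfolding h_def[abs_def] h'_def by (auto intro!: derivative_eq_intros)
  have h': "continuous_on UNIV h'" and h0: "continuous_on UNIV h0"
    unfolding h'_def[abs_def] h0_def[abs_def] by (intro continuous_intros)+
  have g_cont: "continuous_on UNIV g"
    using g(1) DERIV_isCont continuous_at_imp_continuous_on by blast

  \<comment> \<open>Limit eigenvalues and their values as the cutoff width vanishes\<close>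
  define \<mu>1 where "\<mu>1 \<epsilon> m = 2 * integral {0..R} (\<lambda>s. fl \<epsilon> s * (1 - cos (2 * pi * real m * s)))" for \<epsilon> m
  define \<mu>2 where "\<mu>2 \<epsilon> m = - (4 * pi * real m) * integral {0..R} (\<lambda>s. s * fs \<epsilon> s * sin (2 * pi * real m * s))"
    for \<epsilon> m
  define L1 where "L1 m = 2 * integral {0..R} (\<lambda>s. (1 - cos (2 * pi * real m * s)) * g s)" for m
  define L2 where "L2 m = - (4 * pi * real m) * integral {0..R} (\<lambda>s. s * sin (2 * pi * real m * s) * h0 s)" for m
  have eigen: "limit_eigenvalues (fl \<epsilon>) (fs \<epsilon>) m (of_real (\<mu>1 \<epsilon> m)) (of_real (\<mu>2 \<epsilon> m))" if "\<epsilon> > 0" for \<epsilon> m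
    unfolding \<mu>1_def \<mu>2_def fl fs[OF that]
    by (rule limit_eigenvalues_cutoff) (use assms that g h h' in auto)
  \<comment> \<open>The normal profile does not depend on \<open>\<epsilon>\<close>, so its uniform
    error is 0.\<close>
  have "((\<lambda>\<epsilon>. integral {0..R} (\<lambda>s. (1 - cos (2 * pi * real m * s)) * cutoff R \<epsilon> g g' s)) \<longlongrightarrow>
      integral {0..R} (\<lambda>s. (1 - cos (2 * pi * real m * s)) * g s)) (at_right 0)" for m
    by (rule integral_cutoff_tendsto[where \<eta> = "\<lambda>_. 0"])
      (use assms g g_cont in \<open>auto intro!: continuous_intros\<close>)
  from tendsto_mult_left[OF this, of 2]
  have lim1: "((\<lambda>\<epsilon>. \<mu>1 \<epsilon> m) \<longlongrightarrow> L1 m) (at_right 0)" for m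
    by (simp add: \<mu>1_def L1_def fl mult.commute)
  have lim2: "((\<lambda>\<epsilon>. \<mu>2 \<epsilon> m) \<longlongrightarrow> L2 m) (at_right 0)" for m
  proof -
    have "((\<lambda>\<epsilon>. integral {0..R} (\<lambda>s. s * sin (2 * pi * real m * s) * cutoff R \<epsilon> (h \<epsilon>) h' s)) \<longlongrightarrow>
        integral {0..R} (\<lambda>s. s * sin (2 * pi * real m * s) * h0 s)) (at_right 0)"
    \<comment> \<open>\<open>h \<epsilon>\<close> and \<open>h0\<close> differ by a constant in
      \<open>r\<close>, whose modulus serves as the uniform error.\<close>
    proof (rule integral_cutoff_tendsto[OF assms(1) h h' h0])
      have "((\<lambda>\<epsilon>. \<bar>c * exp (- e * R) - c * exp (- e * (R - \<epsilon>))\<bar>) \<longlongrightarrow>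
          \<bar>c * exp (- e * R) - c * exp (- e * (R - 0))\<bar>) (at_right 0)"
        by (intro tendsto_intros)
      then show "((\<lambda>\<epsilon>. \<bar>c * exp (- e * R) - c * exp (- e * (R - \<epsilon>))\<bar>) \<longlongrightarrow> 0) (at_right 0)"
        by simp
    qed (auto intro!: continuous_intros simp: h_def h0_def)
    from tendsto_mult_left[OF this, of "- (4 * pi * real m)"]
    have "((\<lambda>\<epsilon>. - (4 * pi * real m) * integral {0..R} (\<lambda>s. s * sin (2 * pi * real m * s) * cutoff R \<epsilon> (h \<epsilon>) h' s))
      \<longlongrightarrow> L2 m) (at_right 0)"
      unfolding L2_def .
    moreover have "\<forall>\<^sub>F \<epsilon> in at_right 0.
        - (4 * pi * real m) * integral {0..R} (\<lambda>s. s * sin (2 * pi * real m * s) * cutoff R \<epsilon> (h \<epsilon>) h' s) = \<mu>2 \<epsilon> m"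
      using eventually_at_right_less
      by eventually_elim (simp add: \<mu>2_def fs mult_ac)
    ultimately show ?thesis
      by (rule Lim_transform_eventually)
  qed
  have limits: "eps_limit_real_parts fl fs m (L1 m) (L2 m)" for m
    unfolding eps_limit_real_parts_def
  proof (intro exI conjI)
    show "\<forall>\<^sub>F \<epsilon> in at_right 0. limit_eigenvalues (fl \<epsilon>) (fs \<epsilon>) m (of_real (\<mu>1 \<epsilon> m)) (of_real (\<mu>2 \<epsilon> m))"
      using eventually_at_right_less by eventually_elim (rule eigen)
  qed (use lim1 lim2 in simp_all)
  have steady: "steady_state (fl \<epsilon>) (fs \<epsilon>) N (vertical_line N)" if "0 < \<epsilon>" "N \<ge> 1" for \<epsilon> N
    by (rule steady_state_vertical_line) (use that assms(2) in \<open>simp_all add: fs cutoff_eq_0\<close>)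

  \<comment> \<open>Signs of the eigenvalues\<close>
  have stable: "stable_line_eps_limit fl fs" if R: "R = 1/2"
    unfolding stable_line_eps_limit_def
  proof (intro allI impI exI conjI)
    fix m :: nat assume m: "m \<ge> 1"
    show "eps_limit_real_parts fl fs m (L1 m) (L2 m)"
      by (rule limits)
    show "L1 m \<le> 0"
      using g_half[OF R m] by (simp add: L1_def)
    have "(\<lambda>s. s * sin (2 * pi * real m * s) * h0 s)
        = (\<lambda>s. c * (s * (exp (- e * s) - exp (- e * (1/2))) * sin (2 * pi * real m * s)))"
      by (simp add: h0_def R algebra_simps)
    then have "0 \<le> integral {0..R} (\<lambda>s. s * sin (2 * pi * real m * s) * h0 s)"
      using integral_exp_sine_half_nonneg[OF assms(4) m] assms(3)
      unfolding R by (simp only: Henstock_Kurzweil_Integration.integral_mult_right) simp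
    then show "L2 m \<le> 0"
      by (simp add: L2_def)
  qed
  have pos: "\<exists>m\<ge>1. L2 m > 0" if R: "R < 1/2"
  proof -
    obtain m :: nat where m: "m \<ge> 1"
      and "integral {0..R} (\<lambda>s. s * (c * exp (- e * s) - c * exp (- e * R)) * sin (2 * pi * real m * s)) < 0"
      using exists_mode_sine_integral_neg[OF assms(1) R assms(3,4)] by blast
    then have "integral {0..R} (\<lambda>s. s * sin (2 * pi * real m * s) * h0 s) < 0"
      by (simp add: h0_def mult_ac)
    then have "L2 m > 0"
      using m unfolding L2_def by (intro mult_neg_neg) auto
    then show ?thesis
      using m by blast
  qed
  \<comment> \<open>For \<open>R < 1/2\<close> the positive limit \<open>L2 m\<close> persists for
    small \<open>\<epsilon>\<close> in one fixed mode. For \<open>R = 1/2\<close> the limits are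
    nonpositive, so the mode must be chosen after \<open>\<epsilon>\<close>.\<close>
  have unstable: "\<forall>\<^sub>F \<epsilon> in at_right 0. unstable_line (fl \<epsilon>) (fs \<epsilon>)"
  proof (cases "R < 1/2")
    case True
    then obtain m where m: "m \<ge> 1" "L2 m > 0"
      using pos by blast
    have "\<forall>\<^sub>F \<epsilon> in at_right 0. \<mu>2 \<epsilon> m > 0"
      using order_tendstoD(1)[OF lim2 m(2)] .
    then show ?thesis
      using eventually_at_right_less
    proof eventually_elim
      case (elim \<epsilon>)
      then show ?case
        unfolding unstable_line_def using m(1) eigen[OF elim(2), of m] by force
    qed
  next
    case False
    then have R: "R = 1/2"
      using assms(2) by simp
    \<comment> \<open>The three bounds are the smallness conditions on \<open>\<epsilon>\<close> in
      \<open>exists_mode_sine_integral_cutoff_neg\<close>, solved for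
      \<open>\<epsilon>\<close>.\<close>
    define b where "b = Min {1/4, 4 / e, exp (- e / 2) / 2}"
    have "b > 0"
      using assms(4) by (simp add: b_def)
    then have "\<forall>\<^sub>F \<epsilon> in at_right 0. \<epsilon> \<in> {0<..<b}"
      by (rule eventually_at_right_real)
    then show ?thesis
    proof eventually_elim
      case (elim \<epsilon>)
      then have eps: "0 < \<epsilon>" "\<epsilon> < 1/4" "\<epsilon> < 4 / e" "\<epsilon> < exp (- e / 2) / 2"
        unfolding b_def by simp_all
      obtain m :: nat where m: "m \<ge> 1" and "integral {0..1/2} (\<lambda>s. s * cutoff (1/2) \<epsilon>
          (\<lambda>r. c * exp (- e * r) - c * exp (- e * (1/2 - \<epsilon>))) (\<lambda>r. - c * e * exp (- e * r)) s
            * sin (2 * pi * real m * s)) < 0"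
        using exists_mode_sine_integral_cutoff_neg[OF assms(3,4) eps(1)] eps assms(4)
        by (auto simp: field_simps)
      then have "integral {0..R} (\<lambda>s. s * fs \<epsilon> s * sin (2 * pi * real m * s)) < 0"
        unfolding fs[OF eps(1)] unfolding R h_def[abs_def] h'_def[abs_def] by blast
      then have "\<mu>2 \<epsilon> m > 0"
        using m unfolding \<mu>2_def by (intro mult_neg_neg) auto
      then show ?case
        unfolding unstable_line_def using m eigen[OF eps(1), of m] by force
    qed
  qed
  have "unstable_line_eps_limit fl fs" if "R < 1/2"
    unfolding unstable_line_eps_limit_def using pos[OF that] limits by blast
  then show ?thesis
    using steady stable unstable by blast
qed

end
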